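(* Let $p$ be an odd prime, $G=\langle a,b : (a[b,a])^p,\ b^p\rangle$ and $H = G/\bigcap_{k\ge1}\gamma_k(G)$. Then $H$ is a para-$(C_p*C_p)$ group of Type III; in particular $H$ is residually nilpotent, $H/\gamma_i(H)\cong (C_p*C_p)/\gamma_i(C_p*C_p)$ for all $i\geq1$, and $H\not\cong C_p*C_p$.
   Context: Commutator convention: $[x,y]=x^{-1}y^{-1}xy$. $C_p*C_p=\langle a,b:a^p,b^p\rangle$. Lower central series: $\gamma_1(G)=G$, $\gamma_k(G)=[G,\gamma_{k-1}(G)]$; residually nilpotent means $\bigcap_k\gamma_k=\{1\}$. A group $G$ is weakly para-$\Gamma$ if $G/\gamma_k(G)\cong\Gamma/\gamma_k(\Gamma)$ for all $k$, and para-$\Gamma$ if moreover residually nilpotent. For $G=F/N$ weakly para-$\Gamma$ with $F$ free of rank $\mathrm{rk}(\Gamma)$ and $\Gamma=F/K$: $G$ is of Type I if some automorphism $\phi$ of $F$ has $\phi(N)\ge K$; of Type II if some automorphism $\phi$ of $F$ has $\phi(N)\lneq K$; of Type III otherwise. *)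

theory Defs
  imports "HOL-Algebra.Algebra" "HOL-Computational_Algebra.Primes"
begin

text \<open>A letter (x, False) stands for the generator x, (x, True) for its inverse.\<close>

fun red :: "('a \<times> bool) list \<Rightarrow> ('a \<times> bool) list" where
  "red [] = []"
| "red (x # xs) = (case red xs of
       [] \<Rightarrow> [x]
     | y # ys \<Rightarrow> (if fst x = fst y \<and> snd x \<noteq> snd y then ys else x # y # ys))"

definition free_group :: "('a \<times> bool) list monoid" where
  "free_group = \<lparr>carrier = {w. red w = w}, monoid.mult = (\<lambda>u v. red (u @ v)), one = []\<rparr>"

definition free_gen :: "'a \<Rightarrow> ('a \<times> bool) list" where
  "free_gen x = [(x, False)]"

abbreviation F2 :: "(bool \<times> bool) list monoid" where
  "F2 \<equiv> free_group"

abbreviation gen_a :: "(bool \<times> bool) list" where "gen_a \<equiv> free_gen True"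
abbreviation gen_b :: "(bool \<times> bool) list" where "gen_b \<equiv> free_gen False"

definition comm :: "('a, 'b) monoid_scheme \<Rightarrow> 'a \<Rightarrow> 'a \<Rightarrow> 'a" where
  "comm G x y = inv\<^bsub>G\<^esub> x \<otimes>\<^bsub>G\<^esub> inv\<^bsub>G\<^esub> y \<otimes>\<^bsub>G\<^esub> x \<otimes>\<^bsub>G\<^esub> y"

definition normal_closure :: "('a, 'b) monoid_scheme \<Rightarrow> 'a set \<Rightarrow> 'a set" where
  "normal_closure G S =
     generate G (\<Union>g\<in>carrier G. (\<lambda>s. g \<otimes>\<^bsub>G\<^esub> s \<otimes>\<^bsub>G\<^esub> inv\<^bsub>G\<^esub> g) ` S)"

text \<open>Lower central series with the paper's indexing:
  gamma_1 = G, gamma_(k+1) = [G, gamma_k]; gamma_0 is set to G as a harmless convention.\<close>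
fun lower_central :: "('a, 'b) monoid_scheme \<Rightarrow> nat \<Rightarrow> 'a set" where
  "lower_central G 0 = carrier G"
| "lower_central G (Suc 0) = carrier G"
| "lower_central G (Suc (Suc k)) =
     generate G {comm G x y | x y. x \<in> carrier G \<and> y \<in> lower_central G (Suc k)}"

definition residually_nilpotent :: "('a, 'b) monoid_scheme \<Rightarrow> bool" where
  "residually_nilpotent G \<longleftrightarrow> (\<Inter>k\<in>{1..}. lower_central G k) = {\<one>\<^bsub>G\<^esub>}"

definition weakly_para :: "('a, 'b) monoid_scheme \<Rightarrow> ('c, 'd) monoid_scheme \<Rightarrow> bool" where
  "weakly_para G \<Gamma> \<longleftrightarrow>
     (\<forall>k\<ge>1. (G Mod lower_central G k) \<cong> (\<Gamma> Mod lower_central \<Gamma> k))"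

definition para :: "('a, 'b) monoid_scheme \<Rightarrow> ('c, 'd) monoid_scheme \<Rightarrow> bool" where
  "para G \<Gamma> \<longleftrightarrow> weakly_para G \<Gamma> \<and> residually_nilpotent G"

text \<open>Types of a presentation F/N relative to a presentation F/K of Gamma
  (F a free group of rank rk Gamma).\<close>
definition type_I :: "('a, 'b) monoid_scheme \<Rightarrow> 'a set \<Rightarrow> 'a set \<Rightarrow> bool" where
  "type_I F N K \<longleftrightarrow> (\<exists>\<phi>\<in>iso F F. K \<subseteq> \<phi> ` N)"

definition type_II :: "('a, 'b) monoid_scheme \<Rightarrow> 'a set \<Rightarrow> 'a set \<Rightarrow> bool" where
  "type_II F N K \<longleftrightarrow> (\<exists>\<phi>\<in>iso F F. \<phi> ` N \<subset> K)"

definition type_III :: "('a, 'b) monoid_scheme \<Rightarrow> 'a set \<Rightarrow> 'a set \<Rightarrow> bool" where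
  "type_III F N K \<longleftrightarrow> \<not> type_I F N K \<and> \<not> type_II F N K"

definition K_CpCp :: "nat \<Rightarrow> (bool \<times> bool) list set" where
  "K_CpCp p = normal_closure F2 {gen_a [^]\<^bsub>F2\<^esub> p, gen_b [^]\<^bsub>F2\<^esub> p}"

definition CpCp :: "nat \<Rightarrow> (bool \<times> bool) list set monoid" where
  "CpCp p = F2 Mod K_CpCp p"

definition N_G :: "nat \<Rightarrow> (bool \<times> bool) list set" where
  "N_G p = normal_closure F2
     {(gen_a \<otimes>\<^bsub>F2\<^esub> comm F2 gen_b gen_a) [^]\<^bsub>F2\<^esub> p, gen_b [^]\<^bsub>F2\<^esub> p}"

definition G_grp :: "nat \<Rightarrow> (bool \<times> bool) list set monoid" where
  "G_grp p = F2 Mod N_G p"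

definition H_grp :: "nat \<Rightarrow> (bool \<times> bool) list set set monoid" where
  "H_grp p = G_grp p Mod (\<Inter>k\<in>{1..}. lower_central (G_grp p) k)"

text \<open>The kernel N_H of the natural map F2 -> G -> H, so that H = F2/N_H.\<close>
definition N_H :: "nat \<Rightarrow> (bool \<times> bool) list set" where
  "N_H p = {w \<in> carrier F2. N_G p #>\<^bsub>F2\<^esub> w \<in> (\<Inter>k\<in>{1..}. lower_central (G_grp p) k)}"

end

theory Submission
  imports Defs Complex_Main "HOL-Computational_Algebra.Polynomial"
begin

text \<open>
  The endomorphism \<open>twist\<close> of \<open>F2\<close> with \<open>a \<mapsto> a[b,a]\<close>, \<open>b \<mapsto> b\<close> is the identity on the
  abelianisation, hence invertible modulo every \<open>\<gamma>\<^sub>k\<close>, and it carries the relators of \<open>C\<^sub>p * C\<^sub>p\<close>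
  to those of \<open>G\<close>; so all nilpotent quotients agree.

  There is no surjection from \<open>G\<close> onto \<open>C\<^sub>p * C\<^sub>p\<close>. Represent \<open>C\<^sub>p * C\<^sub>p\<close> in \<open>SL\<^sub>2(\<complex>[z])\<close> such that the
  product of the two generators has nonconstant trace, and let \<open>A, B\<close> be the images of the
  generators of \<open>G\<close>. Elements of order \<open>p\<close> have constant nonzero trace, and with \<open>u = tr A\<close>,
  \<open>t = tr B\<close>, \<open>v = tr AB\<close> one has \<open>tr (A[B,A]) = u(u\<^sup>2 + v\<^sup>2 + t\<^sup>2 - uvt - 3)\<close>. So \<open>u\<close>, \<open>t\<close>, \<open>v\<close> are
  constant, and then so are the traces of all elements generated by \<open>A\<close> and \<open>B\<close>. This excludes
  an isomorphism as well as Type II.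

  For Type I, a surjection \<open>C\<^sub>p * C\<^sub>p \<rightarrow> H\<close> induces, for every finite nilpotent group \<open>Q\<close>, an injection
  from homomorphisms \<open>H \<rightarrow> Q\<close> to homomorphisms \<open>C\<^sub>p * C\<^sub>p \<rightarrow> Q\<close>. Both sets are finite of the same size,
  so every homomorphism from \<open>C\<^sub>p * C\<^sub>p\<close> to \<open>Q\<close> factors through \<open>H\<close>. As unitriangular groups modulo
  \<open>p\<close> separate the elements of \<open>C\<^sub>p * C\<^sub>p\<close>, the surjection is injective, which was excluded.
\<close>

section \<open>Free groups\<close>

text \<open>The case split of \<open>red\<close> as an operator on already reduced words. Since
  \<open>red\<close> is its right fold, facts about the free group reduce to how single letters act
  on reduced words.\<close>

definition letter_cons :: "'a \<times> bool \<Rightarrow> ('a \<times> bool) list \<Rightarrow> ('a \<times> bool) list" where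
  "letter_cons x w = (case w of [] \<Rightarrow> [x]
     | y # ys \<Rightarrow> (if fst x = fst y \<and> snd x \<noteq> snd y then ys else x # y # ys))"

definition inv_letter :: "'a \<times> bool \<Rightarrow> 'a \<times> bool" where
  "inv_letter x = (fst x, \<not> snd x)"

lemma inv_letter_inv_letter [simp]: "inv_letter (inv_letter x) = x"
  by (simp add: inv_letter_def)

lemma red_Cons_letter_cons: "red (x # w) = letter_cons x (red w)"
  by (simp add: letter_cons_def)

lemma red_Cons_cases:
  "red (x # w) = x # red w \<or> (\<exists>ys. red w = inv_letter x # ys \<and> red (x # w) = ys)"
  by (cases "red w"; cases x; auto simp: inv_letter_def)

text \<open>Reduction never lengthens a word. A cancellation at the head would leave a word shorter
  than \<open>x # w\<close>, so the head is kept and the tail is its own reduction.\<close>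

lemma red_tl: "red (x # w) = x # w \<Longrightarrow> red w = w"
proof -
  have len: "length (red v) \<le> length v" for v :: "('a \<times> bool) list"
    by (induction v) (auto split: list.splits)
  assume "red (x # w) = x # w"
  with red_Cons_cases[of x w] len[of w] show "red w = w"
    by auto
qed

lemma red_red [simp]: "red (red w) = red w"
proof (induction w)
  case (Cons x w)
  then show ?case
    using red_Cons_cases[of x w] red_tl[of "inv_letter x"]
    by (smt (verit, best) red_Cons_letter_cons)
qed simp

text \<open>Van der Waerden's method: a letter and its inverse act on reduced words as mutually
  inverse permutations. If \<open>w\<close> starts with \<open>x\<close>, reducedness prevents its
  tail from starting with the inverse letter, so \<open>x\<close> is simply put back.\<close>

lemma letter_cons_cancel:
  assumes "red w = w"
  shows "letter_cons x (letter_cons (inv_letter x) w) = w"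
proof (cases "\<exists>ys. w = x # ys")
  case True
  then obtain ys where w: "w = x # ys" by blast
  then have "red ys = ys" using assms red_tl by blast
  then have "letter_cons x ys = w"
    using assms red_Cons_letter_cons[of x ys] w by metis
  moreover have "letter_cons (inv_letter x) w = ys"
    by (simp add: w letter_cons_def inv_letter_def)
  ultimately show ?thesis by simp
next
  case False
  then have "letter_cons (inv_letter x) w = inv_letter x # w"
    by (cases w; cases x) (auto simp: letter_cons_def inv_letter_def)
  then show ?thesis by (simp add: letter_cons_def inv_letter_def)
qed

text \<open>Together with \<open>red_append_red2\<close> this is associativity of the free group.
  Only a cancelling head letter needs work: it and the inverse letter in front of
  \<open>red u\<close> act trivially on the rest by \<open>letter_cons_cancel\<close>.\<close>

lemma red_append_red1: "red (red u @ v) = red (u @ v)"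
proof (induction u)
  case (Cons x u)
  from red_Cons_cases[of x u] show ?case
  proof
    assume "\<exists>ys. red u = inv_letter x # ys \<and> red (x # u) = ys"
    then obtain ys where ys: "red u = inv_letter x # ys" "red (x # u) = ys" by blast
    have "red ((x # u) @ v) = letter_cons x (red (red u @ v))"
      by (simp add: Cons.IH red_Cons_letter_cons del: red.simps)
    also have "\<dots> = letter_cons x (letter_cons (inv_letter x) (red (ys @ v)))"
      by (simp add: ys red_Cons_letter_cons del: red.simps)
    also have "\<dots> = red (ys @ v)"
      by (simp add: letter_cons_cancel)
    finally show ?thesis by (simp add: ys del: red.simps)
  qed (simp add: Cons.IH)
qed simp

lemma red_append_red2: "red (u @ red v) = red (u @ v)"
  by (induction u) auto

lemma carrier_free_group: "carrier free_group = {w. red w = w}"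
  and mult_free_group: "u \<otimes>\<^bsub>free_group\<^esub> v = red (u @ v)"
  and one_free_group: "\<one>\<^bsub>free_group\<^esub> = []"
  by (simp_all add: free_group_def)

lemma red_inverse_append: "red (rev (map inv_letter w) @ w) = []"
proof (induction w)
  case (Cons x w)
  have "red (rev (map inv_letter (x # w)) @ x # w)
      = red (rev (map inv_letter w) @ red (inv_letter x # x # w))"
    by (simp add: red_append_red2 del: red.simps)
  also have "red (inv_letter x # x # w) = red w"
    using letter_cons_cancel[of "red w" "inv_letter x"] by (simp add: red_Cons_letter_cons del: red.simps)
  finally show ?case by (simp add: red_append_red2 Cons.IH)
qed simp

lemma group_free_group: "group free_group"
proof (rule groupI)
  fix x :: "('a \<times> bool) list"
  assume "x \<in> carrier free_group"
  have "red (red (rev (map inv_letter x)) @ x) = []"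
    by (simp add: red_append_red1 red_inverse_append)
  then show "\<exists>y\<in>carrier free_group. y \<otimes>\<^bsub>free_group\<^esub> x = \<one>\<^bsub>free_group\<^esub>"
    by (intro bexI[of _ "red (rev (map inv_letter x))"])
      (simp_all add: carrier_free_group mult_free_group one_free_group)
qed (simp_all add: carrier_free_group mult_free_group one_free_group red_append_red1 red_append_red2)

interpretation F: group "free_group :: ('a \<times> bool) list monoid"
  by (rule group_free_group)

lemma free_gen_closed [simp]: "free_gen c \<in> carrier free_group"
  by (simp add: carrier_free_group free_gen_def)

lemma inv_free_gen: "inv\<^bsub>free_group\<^esub> (free_gen c) = [(c, True)]"
  by (rule F.inv_equality)
    (simp_all add: carrier_free_group mult_free_group one_free_group free_gen_def)

text \<open>Tails of reduced words are reduced, so a nonempty reduced word is the group product of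
  its first letter and its tail. This turns list induction into induction over generators and their
  inverses.\<close>

lemma free_group_induct [consumes 1, case_names one gen inv]:
  assumes "w \<in> carrier free_group"
    and "P \<one>\<^bsub>free_group\<^esub>"
    and "\<And>c w. w \<in> carrier free_group \<Longrightarrow> P w \<Longrightarrow> P (free_gen c \<otimes>\<^bsub>free_group\<^esub> w)"
    and "\<And>c w. w \<in> carrier free_group \<Longrightarrow> P w \<Longrightarrow> P (inv\<^bsub>free_group\<^esub> (free_gen c) \<otimes>\<^bsub>free_group\<^esub> w)"
  shows "P w"
  using assms(1)
proof (induction w)
  case Nil
  then show ?case using assms(2) by (simp add: one_free_group)
next
  case (Cons x w)
  obtain c b where x: "x = (c, b)" by (cases x)
  have red: "red (x # w) = x # w"
    using Cons.prems by (simp add: carrier_free_group)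
  then have w: "w \<in> carrier free_group"
    using red_tl by (simp add: carrier_free_group)
  have "x # w = (if b then inv\<^bsub>free_group\<^esub> (free_gen c) else free_gen c) \<otimes>\<^bsub>free_group\<^esub> w"
    unfolding inv_free_gen using red by (auto simp: x mult_free_group free_gen_def simp del: red.simps)
  then show ?case
    using assms(3)[OF w Cons.IH[OF w], of c] assms(4)[OF w Cons.IH[OF w], of c] by (cases b) simp_all
qed

section \<open>The universal property of free groups\<close>

definition free_lift :: "('b, 'c) monoid_scheme \<Rightarrow> ('a \<Rightarrow> 'b) \<Rightarrow> ('a \<times> bool) list \<Rightarrow> 'b" where
  "free_lift G f w = foldr (\<lambda>x. (\<otimes>\<^bsub>G\<^esub>) (if snd x then inv\<^bsub>G\<^esub> f (fst x) else f (fst x))) w \<one>\<^bsub>G\<^esub>"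

context group
begin

lemma free_lift_Nil: "free_lift G f [] = \<one>"
  and free_lift_Cons: "free_lift G f (x # w) = (if snd x then inv f (fst x) else f (fst x)) \<otimes> free_lift G f w"
  by (simp_all add: free_lift_def)

lemma free_lift_closed:
  assumes "range f \<subseteq> carrier G"
  shows "free_lift G f w \<in> carrier G"
  using assms by (induction w) (auto simp: free_lift_Nil free_lift_Cons)

text \<open>\<open>free_lift\<close> is evaluated on arbitrary words. A cancelled pair contributes
  an element times its inverse, so evaluation is invariant under reduction; with compatibility with
  concatenation this gives a homomorphism.\<close>

lemma free_lift_red:
  assumes f: "range f \<subseteq> carrier G"
  shows "free_lift G f (red w) = free_lift G f w"
proof (induction w)
  case (Cons x w)
  have fc: "f c \<in> carrier G" for c using f by auto
  from red_Cons_cases[of x w] show ?case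
  proof
    assume "\<exists>ys. red w = inv_letter x # ys \<and> red (x # w) = ys"
    then obtain ys where ys: "red w = inv_letter x # ys" "red (x # w) = ys" by blast
    have "free_lift G f (x # w) = free_lift G f (x # inv_letter x # ys)"
      using Cons.IH by (simp add: ys(1) free_lift_Cons)
    also have "\<dots> = free_lift G f ys"
      using free_lift_closed[OF f, of ys]
      by (auto simp: free_lift_Cons inv_letter_def m_assoc[symmetric] fc)
    finally show ?thesis by (simp add: ys del: red.simps)
  qed (simp add: free_lift_Cons Cons.IH)
qed simp

lemma free_lift_append:
  assumes "range f \<subseteq> carrier G"
  shows "free_lift G f (u @ v) = free_lift G f u \<otimes> free_lift G f v"
proof -
  have "f c \<in> carrier G" for c using assms by auto
  then show ?thesis
    by (induction u) (simp_all add: free_lift_Nil free_lift_Cons m_assoc free_lift_closed assms)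
qed

lemma free_lift_hom:
  assumes "range f \<subseteq> carrier G"
  shows "free_lift G f \<in> hom free_group G"
  using assms
  by (auto intro!: homI simp: mult_free_group free_lift_red free_lift_append free_lift_closed)

lemma free_lift_gen:
  assumes "range f \<subseteq> carrier G"
  shows "free_lift G f (free_gen c) = f c"
proof -
  have "f c \<in> carrier G" using assms by auto
  then show ?thesis by (simp add: free_gen_def free_lift_Nil free_lift_Cons)
qed

lemma free_hom_eqI:
  assumes h: "h \<in> hom free_group G" and k: "k \<in> hom free_group G"
    and "\<And>c. h (free_gen c) = k (free_gen c)"
    and "w \<in> carrier free_group"
  shows "h w = k w"
proof -
  interpret h: group_hom free_group G h
    using h by (simp add: group_hom_def group_hom_axioms_def group_free_group)
  interpret k: group_hom free_group G k
    using k by (simp add: group_hom_def group_hom_axioms_def group_free_group)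
  show ?thesis
    using assms(4) by (induction w rule: free_group_induct) (simp_all add: assms(3))
qed

end

section \<open>The lower central series\<close>

context group
begin

lemma comm_closed [simp]: "x \<in> carrier G \<Longrightarrow> y \<in> carrier G \<Longrightarrow> comm G x y \<in> carrier G"
  by (simp add: comm_def)

lemma comm_eq_one_iff:
  assumes "x \<in> carrier G" "y \<in> carrier G"
  shows "comm G x y = \<one> \<longleftrightarrow> x \<otimes> y = y \<otimes> x"
proof -
  have "comm G x y = inv (y \<otimes> x) \<otimes> (x \<otimes> y)"
    using assms by (simp add: comm_def inv_mult_group m_assoc)
  then show ?thesis
    using assms by (metis inv_solve_left l_inv m_closed r_one one_closed inv_closed)
qed

lemma comm_conj:
  assumes "x \<in> carrier G" "y \<in> carrier G" "g \<in> carrier G"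
  shows "g \<otimes> comm G x y \<otimes> inv g = comm G (g \<otimes> x \<otimes> inv g) (g \<otimes> y \<otimes> inv g)"
proof -
  have "inv g \<otimes> (g \<otimes> a) = a" if "a \<in> carrier G" for a
    using that assms by (simp add: m_assoc[symmetric])
  then show ?thesis
    using assms by (simp add: comm_def inv_mult_group m_assoc)
qed

text \<open>Write \<open>[x,y]\<close> as the inverse of \<open>yx\<close> times \<open>xy\<close>.
  Both products acquire the same central factor \<open>zt\<close>, which cancels.\<close>

lemma comm_central_mult:
  assumes car: "x \<in> carrier G" "y \<in> carrier G" "z \<in> carrier G" "t \<in> carrier G"
    and z: "\<And>g. g \<in> carrier G \<Longrightarrow> z \<otimes> g = g \<otimes> z"
    and t: "\<And>g. g \<in> carrier G \<Longrightarrow> t \<otimes> g = g \<otimes> t"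
  shows "comm G (z \<otimes> x) (t \<otimes> y) = comm G x y"
proof -
  have "(z \<otimes> x) \<otimes> (t \<otimes> y) = (z \<otimes> t) \<otimes> (x \<otimes> y)"
    using car t[of x] by (simp add: m_assoc) (metis m_assoc)
  moreover have "(t \<otimes> y) \<otimes> (z \<otimes> x) = (z \<otimes> t) \<otimes> (y \<otimes> x)"
    using car z[of y] t[of z] by (metis m_assoc m_closed)
  moreover have "comm G a b = inv (b \<otimes> a) \<otimes> (a \<otimes> b)"
    if "a \<in> carrier G" "b \<in> carrier G" for a b
    using that by (simp add: comm_def inv_mult_group m_assoc)
  ultimately have "comm G (z \<otimes> x) (t \<otimes> y) = inv ((z \<otimes> t) \<otimes> (y \<otimes> x)) \<otimes> ((z \<otimes> t) \<otimes> (x \<otimes> y))"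
    using car by simp
  also have "\<dots> = inv (y \<otimes> x) \<otimes> (inv (z \<otimes> t) \<otimes> (z \<otimes> t)) \<otimes> (x \<otimes> y)"
    using car inv_mult_group[of "z \<otimes> t" "y \<otimes> x"]
    by (metis m_assoc m_closed inv_closed)
  also have "\<dots> = comm G x y"
    using car l_inv[of "z \<otimes> t"] by (simp del: l_inv) (simp add: comm_def inv_mult_group m_assoc)
  finally show ?thesis .
qed

text \<open>Conjugation respects commutators and the preceding term is normal by induction, so the
  generating set is closed under conjugation.\<close>

lemma normal_lower_central: "lower_central G k \<lhd> G"
proof (induction G\<equiv>G k rule: lower_central.induct)
  case (3 k)
  have sub: "lower_central G (Suc k) \<subseteq> carrier G"
    using 3 normal_imp_subgroup subgroup.subset by blast
  show ?case
    unfolding lower_central.simps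
  proof (rule normal_generateI)
    fix h g
    assume "h \<in> {comm G x y | x y. x \<in> carrier G \<and> y \<in> lower_central G (Suc k)}" and g: "g \<in> carrier G"
    then obtain x y where xy: "h = comm G x y" "x \<in> carrier G" "y \<in> lower_central G (Suc k)" by blast
    then show "g \<otimes> h \<otimes> inv g \<in> {comm G x y | x y. x \<in> carrier G \<and> y \<in> lower_central G (Suc k)}"
      using g sub normal_invE(2)[OF 3 g xy(3)] comm_conj[of x y g]
      by (simp add: subset_iff) (metis inv_closed m_closed)
  qed (use sub in auto)
qed (simp_all add: normal_self)

lemma subgroup_lower_central: "subgroup (lower_central G k) G"
  using normal_lower_central normal_imp_subgroup by blast

lemma lower_central_closed: "x \<in> lower_central G k \<Longrightarrow> x \<in> carrier G"
  using subgroup_lower_central subgroup.mem_carrier by metis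

lemma comm_in_lower_central:
  assumes "x \<in> carrier G" "y \<in> lower_central G k"
  shows "comm G x y \<in> lower_central G (Suc k)"
proof (cases k)
  case 0
  with assms show ?thesis by simp
next
  case (Suc j)
  then show ?thesis using assms by (auto intro!: generate.incl)
qed

lemma lower_central_Suc_subset: "lower_central G (Suc k) \<subseteq> lower_central G k"
proof (cases k)
  case (Suc j)
  have "generate G {comm G x y | x y. x \<in> carrier G \<and> y \<in> lower_central G k} \<subseteq> lower_central G k"
  proof (rule generate_subgroup_incl)
    show "{comm G x y | x y. x \<in> carrier G \<and> y \<in> lower_central G k} \<subseteq> lower_central G k"
    proof clarify
      fix x y
      assume x: "x \<in> carrier G" and y: "y \<in> lower_central G k"
      have "inv y \<in> lower_central G k"
        using y subgroup_lower_central subgroup.m_inv_closed by metis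
      then have "inv x \<otimes> inv y \<otimes> inv (inv x) \<in> lower_central G k"
        using normal_invE(2)[OF normal_lower_central] x inv_closed by blast
      then show "comm G x y \<in> lower_central G k"
        using x y subgroup.m_closed[OF subgroup_lower_central] by (simp add: comm_def)
    qed
  qed (rule subgroup_lower_central)
  then show ?thesis using Suc by simp
qed simp

lemma lower_central_antimono: "j \<le> k \<Longrightarrow> lower_central G k \<subseteq> lower_central G j"
  using lower_central_Suc_subset by (rule lift_Suc_antimono_le)

section \<open>Cosets, quotient maps and normal closures\<close>

lemma coset_eq_iff:
  assumes "N \<lhd> G" "x \<in> carrier G" "y \<in> carrier G"
  shows "N #> x = N #> y \<longleftrightarrow> x \<otimes> inv y \<in> N"
proof -
  interpret N: normal N G by fact
  have "x \<otimes> inv y \<in> N \<longleftrightarrow> x \<in> N #> y"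
    using N.rcos_module[OF is_group] assms by blast
  then show ?thesis
    using assms repr_independence[OF _ _ N.subgroup_axioms] rcos_self[OF _ N.subgroup_axioms] by blast
qed

lemma coset_eq_one_iff:
  assumes "N \<lhd> G" "x \<in> carrier G"
  shows "N #> x = \<one>\<^bsub>G Mod N\<^esub> \<longleftrightarrow> x \<in> N"
  using coset_eq_iff[OF assms, of \<one>] assms normal_imp_subgroup[OF assms(1)] coset_mult_one subgroup.subset
  by fastforce

lemma group_hom_Mod:
  assumes "N \<lhd> G"
  shows "group_hom G (G Mod N) (\<lambda>x. N #> x)"
  using assms normal.r_coset_hom_Mod normal.factorgroup_is_group is_group
  by (auto simp: group_hom_def group_hom_axioms_def)

lemma normal_normal_closure:
  assumes "S \<subseteq> carrier G"
  shows "normal_closure G S \<lhd> G"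
  unfolding normal_closure_def
proof (rule normal_generateI)
  fix h g
  assume "h \<in> (\<Union>g\<in>carrier G. (\<lambda>s. g \<otimes> s \<otimes> inv g) ` S)" and g: "g \<in> carrier G"
  then obtain k s where k: "k \<in> carrier G" "s \<in> S" "h = k \<otimes> s \<otimes> inv k" by blast
  then have "g \<otimes> h \<otimes> inv g = (g \<otimes> k) \<otimes> s \<otimes> inv (g \<otimes> k)"
    using g assms by (auto simp: inv_mult_group m_assoc subset_iff)
  then show "g \<otimes> h \<otimes> inv g \<in> (\<Union>g\<in>carrier G. (\<lambda>s. g \<otimes> s \<otimes> inv g) ` S)"
    using g k by blast
qed (use assms in auto)

lemma normal_closure_incl:
  assumes "S \<subseteq> carrier G" "s \<in> S"
  shows "s \<in> normal_closure G S"
  unfolding normal_closure_def using assms by (intro generate.incl UN_I[of \<one>]) (auto intro!: image_eqI[of _ _ s])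

lemma normal_closure_minimal:
  assumes "N \<lhd> G" "S \<subseteq> N"
  shows "normal_closure G S \<subseteq> N"
  unfolding normal_closure_def
  using assms normal_invE[OF assms(1)] by (intro generate_subgroup_incl) auto

end

lemma (in group_hom) hom_comm:
  "x \<in> carrier G \<Longrightarrow> y \<in> carrier G \<Longrightarrow> h (comm G x y) = comm H (h x) (h y)"
  by (simp add: comm_def)

lemma (in group_hom) hom_lower_central:
  "x \<in> lower_central G k \<Longrightarrow> h x \<in> lower_central H k"
proof (induction k arbitrary: x)
  case (Suc k)
  show ?case
  proof (cases k)
    case 0
    then show ?thesis using Suc.prems by simp
  next
    case (Suc j)
    have "x \<in> generate G {comm G x y | x y. x \<in> carrier G \<and> y \<in> lower_central G k}"
      using Suc.prems Suc by simp
    then show ?thesis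
    proof induction
      case one
      then show ?case using subgroup.one_closed[OF H.subgroup_lower_central] by simp
    next
      case (incl g)
      then show ?case
        using Suc.IH H.comm_in_lower_central G.lower_central_closed by (auto simp: hom_comm)
    next
      case (inv g)
      then have "h g \<in> lower_central H (Suc k)" "g \<in> carrier G"
        using Suc.IH H.comm_in_lower_central G.lower_central_closed by (auto simp: hom_comm)
      then show ?case
        using subgroup.m_inv_closed[OF H.subgroup_lower_central] by simp
    next
      case (eng g g')
      have "generate G {comm G x y | x y. x \<in> carrier G \<and> y \<in> lower_central G k} \<subseteq> carrier G"
        using G.lower_central_closed by (intro G.generate_incl) auto
      with eng show ?case
        using subgroup.m_closed[OF H.subgroup_lower_central] by (auto simp: subset_iff)
    qed
  qed
qed simp

text \<open>Surjectivity allows both entries of a commutator in \<open>H\<close> to be lifted, the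
  second into the preceding term by induction.\<close>

lemma (in group_hom) lower_central_image:
  assumes "h ` carrier G = carrier H"
  shows "h ` lower_central G k = lower_central H k"
proof
  show "h ` lower_central G k \<subseteq> lower_central H k"
    using hom_lower_central by blast
  show "lower_central H k \<subseteq> h ` lower_central G k"
  proof (induction H\<equiv>H k rule: lower_central.induct)
    case (3 k)
    show ?case
      unfolding lower_central.simps(3)[of H]
    proof (rule H.generate_subgroup_incl)
      show "subgroup (h ` lower_central G (Suc (Suc k))) H"
        using subgroup_img_is_subgroup G.subgroup_lower_central by blast
      show "{comm H x y | x y. x \<in> carrier H \<and> y \<in> lower_central H (Suc k)} \<subseteq> h ` lower_central G (Suc (Suc k))"
      proof clarify
        fix x y
        assume "x \<in> carrier H" "y \<in> lower_central H (Suc k)"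
        then obtain x' y' where "x = h x'" "x' \<in> carrier G" "y = h y'" "y' \<in> lower_central G (Suc k)"
          using 3 assms by blast
        then show "comm H x y \<in> h ` lower_central G (Suc (Suc k))"
          using G.comm_in_lower_central[of x' y' "Suc k"] G.lower_central_closed[of y' "Suc k"]
          by (metis hom_comm imageI)
      qed
    qed
  qed (simp_all add: assms)
qed

lemma (in group) lower_central_Mod:
  assumes "N \<lhd> G"
  shows "lower_central (G Mod N) k = (\<lambda>x. N #> x) ` lower_central G k"
  using group_hom.lower_central_image[OF group_hom_Mod[OF assms]] by (simp add: carrier_FactGroup)

text \<open>Supplies the nilpotency hypothesis of \<open>hom_eq_of_coset_eq\<close> and
  \<open>nilpotent_kills\<close> when the target is a quotient by a term of the series.\<close>

lemma (in group) lower_central_Mod_lower_central: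
  "lower_central (G Mod lower_central G k) k = {\<one>\<^bsub>G Mod lower_central G k\<^esub>}"
proof -
  have "(\<lambda>x. lower_central G k #> x) ` lower_central G k \<subseteq> {\<one>\<^bsub>G Mod lower_central G k\<^esub>}"
    using coset_eq_one_iff[OF normal_lower_central] lower_central_closed by auto
  moreover have "\<one>\<^bsub>G Mod lower_central G k\<^esub> \<in> lower_central (G Mod lower_central G k) k"
    using group.subgroup_lower_central subgroup.one_closed normal.factorgroup_is_group
      normal_lower_central by metis
  ultimately show ?thesis
    using lower_central_Mod[OF normal_lower_central, of k k] by (simp only: subset_singleton_iff) blast
qed

text \<open>Elements of \<open>\<gamma>\<^sub>k\<close> are central modulo \<open>\<gamma>\<^sub>k\<^sub>+\<^sub>1\<close>, so commutators modulo \<open>\<gamma>\<^sub>k\<^sub>+\<^sub>1\<close>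
  only depend on their arguments modulo \<open>\<gamma>\<^sub>k\<close>.\<close>

lemma (in group) subgroup_covers_lower_central_quotients:
  assumes S: "subgroup S G"
    and base: "\<And>g. g \<in> carrier G \<Longrightarrow> \<exists>s\<in>S. lower_central G 2 #> g = lower_central G 2 #> s"
    and "g \<in> carrier G"
  shows "\<exists>s\<in>S. lower_central G k #> g = lower_central G k #> s"
proof -
  \<comment> \<open>The index is shifted by 2 so that the induction starts at the hypothesis
    \<open>base\<close>; the smaller indices follow at the end because the series decreases.\<close>
  have "\<forall>g\<in>carrier G. \<exists>s\<in>S. lower_central G (k + 2) #> g = lower_central G (k + 2) #> s" for k
  proof (induction k)
    case 0
    then show ?case using base unfolding add_0 by blast
  next
    case (Suc k)
    define N where "N = lower_central G (Suc k + 2)"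
    define Q where "Q = G Mod N"
    define q where "q x = N #> x" for x
    interpret q: group_hom G "Q" q
      unfolding q_def Q_def N_def by (rule group_hom_Mod) (rule normal_lower_central)
    have surj: "carrier Q = q ` carrier G" by (simp add: Q_def q_def carrier_FactGroup)
    have central: "q c \<otimes>\<^bsub>Q\<^esub> y = y \<otimes>\<^bsub>Q\<^esub> q c"
      if "c \<in> lower_central G (k + 2)" "y \<in> carrier (Q)" for c y
    proof -
      obtain x where x: "x \<in> carrier G" "y = q x"
        using \<open>y \<in> carrier (Q)\<close> by (auto simp: surj)
      have c: "c \<in> carrier G" using that lower_central_closed by blast
      have "comm G x c \<in> N"
        using comm_in_lower_central[OF x(1) that(1)] unfolding N_def add_Suc .
      then have "q (comm G x c) = \<one>\<^bsub>Q\<^esub>"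
        unfolding q_def Q_def N_def using coset_eq_one_iff[OF normal_lower_central comm_closed[OF x(1) c]] by (simp only: N_def)
      then have "comm (Q) (q x) (q c) = \<one>\<^bsub>Q\<^esub>"
        using q.hom_comm x c by simp
      then show ?thesis
        using q.H.comm_eq_one_iff x c by simp
    qed
    \<comment> \<open>The elements already covered by \<open>S\<close> at the next level. It is a
      subgroup containing \<open>S\<close>, so it remains to see that it contains
      \<open>\<gamma>\<^sub>2\<close>.\<close>
    define T where "T = {g \<in> carrier G. q g \<in> q ` S}"
    have ST: "S \<subseteq> T" using subgroup.subset[OF S] by (auto simp: T_def)
    have T: "subgroup T G"
    proof (rule subgroupI)
      have qS: "subgroup (q ` S) (Q)" using q.subgroup_img_is_subgroup[OF S] .
      show "T \<noteq> {}" using ST subgroup.one_closed[OF S] by blast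
      show "inv a \<in> T" if "a \<in> T" for a
        using that subgroup.m_inv_closed[OF qS] by (auto simp: T_def)
      show "a \<otimes> b \<in> T" if "a \<in> T" "b \<in> T" for a b
        using that subgroup.m_closed[OF qS] by (auto simp: T_def)
    qed (auto simp: T_def)
    \<comment> \<open>The induction hypothesis writes every element as \<open>c\<close> times
      \<open>s\<close>, with \<open>c\<close> in the current term and hence central modulo the next
      one.\<close>
    have dec: "\<exists>s\<in>S. \<exists>c\<in>lower_central G (k + 2). q x = q c \<otimes>\<^bsub>Q\<^esub> q s" if x: "x \<in> carrier G" for x
    proof -
      obtain s where s: "s \<in> S" "lower_central G (k + 2) #> x = lower_central G (k + 2) #> s"
        using Suc x by blast
      have sc: "s \<in> carrier G" using s subgroup.subset[OF S] by blast
      have "x \<otimes> inv s \<in> lower_central G (k + 2)"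
        using s sc x coset_eq_iff normal_lower_central by blast
      moreover have "q x = q (x \<otimes> inv s) \<otimes>\<^bsub>Q\<^esub> q s"
        using x sc by (subst q.hom_mult[symmetric]) (simp_all add: m_assoc)
      ultimately show ?thesis using s by blast
    qed
    \<comment> \<open>Dropping the central factors, a commutator has the same image under
      \<open>q\<close> as the commutator of the two representatives in \<open>S\<close>.\<close>
    have "lower_central G (Suc (Suc 0)) \<subseteq> T"
      unfolding lower_central.simps
    proof (intro generate_subgroup_incl T subsetI, clarify)
      fix x y
      assume x: "x \<in> carrier G" and y: "y \<in> carrier G"
      obtain s c where s: "s \<in> S" "c \<in> lower_central G (k + 2)" "q x = q c \<otimes>\<^bsub>Q\<^esub> q s"
        using dec[OF x] by blast
      obtain t d where t: "t \<in> S" "d \<in> lower_central G (k + 2)" "q y = q d \<otimes>\<^bsub>Q\<^esub> q t"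
        using dec[OF y] by blast
      have car: "s \<in> carrier G" "t \<in> carrier G" "c \<in> carrier G" "d \<in> carrier G"
        using s t subgroup.subset[OF S] lower_central_closed by blast+
      have "q (comm G x y) = comm (Q) (q s) (q t)"
        using q.H.comm_central_mult[of "q s" "q t" "q c" "q d"] central s t car x y
        by (simp add: q.hom_comm)
      also have "\<dots> = q (comm G s t)"
        using car by (simp add: q.hom_comm)
      finally have "q (comm G x y) \<in> q ` S"
        using s t subgroup.m_closed[OF S] subgroup.m_inv_closed[OF S] by (auto simp: comm_def)
      then show "comm G x y \<in> T"
        using x y by (simp add: T_def)
    qed
    then have two: "lower_central G 2 \<subseteq> T" by (simp add: numeral_2_eq_2)
    have "\<forall>g\<in>carrier G. \<exists>s\<in>S. N #> g = N #> s"
    proof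
      fix x
      assume x: "x \<in> carrier G"
      then obtain s where s: "s \<in> S" "lower_central G 2 #> x = lower_central G 2 #> s"
        using base by blast
      have sc: "s \<in> carrier G" using s subgroup.subset[OF S] by blast
      \<comment> \<open>By \<open>base\<close>, \<open>x\<close> differs from an element of
        \<open>S\<close> by an element of \<open>\<gamma>\<^sub>2\<close>, and both lie in
        \<open>T\<close>.\<close>
      have "x \<otimes> inv s \<in> T"
        using s sc x coset_eq_iff normal_lower_central two by blast
      then have "x \<otimes> inv s \<otimes> s \<in> T"
        using subgroup.m_closed[OF T] ST s by blast
      then have "q x \<in> q ` S"
        using x sc by (simp add: m_assoc T_def)
      then show "\<exists>s\<in>S. N #> x = N #> s" by (auto simp: q_def)
    qed
    then show ?case unfolding N_def .
  qed
  then obtain s where s: "s \<in> S" "lower_central G (k + 2) #> g = lower_central G (k + 2) #> s"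
    using assms(3) by blast
  have sc: "s \<in> carrier G" using s subgroup.subset[OF S] by blast
  have "g \<otimes> inv s \<in> lower_central G (k + 2)"
    using coset_eq_iff[OF normal_lower_central assms(3) sc] s(2) by blast
  then have "lower_central G k #> g = lower_central G k #> s"
    using coset_eq_iff[OF normal_lower_central assms(3) sc] lower_central_antimono[OF le_add1] by blast
  then show ?thesis using s(1) by blast
qed

lemma group_hom_comp:
  assumes "group_hom A B f" "group_hom B C g"
  shows "group_hom A C (\<lambda>x. g (f x))"
proof -
  interpret f: group_hom A B f by fact
  interpret g: group_hom B C g by fact
  show ?thesis by unfold_locales (auto intro: homI)
qed

section \<open>Quotients\<close>

lemma iso_of_same_kernel:
  assumes "group_hom G A f" "group_hom G B g"
    and "f ` carrier G = carrier A" "g ` carrier G = carrier B"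
    and "\<And>x. x \<in> carrier G \<Longrightarrow> f x = \<one>\<^bsub>A\<^esub> \<longleftrightarrow> g x = \<one>\<^bsub>B\<^esub>"
  shows "A \<cong> B"
proof -
  interpret f: group_hom G A f by fact
  interpret g: group_hom G B g by fact
  have "kernel G A f = kernel G B g"
    using assms(5) by (auto simp: kernel_def)
  then have "G Mod kernel G A f \<cong> B"
    using g.FactGroup_iso assms(4) by simp
  moreover have "A \<cong> G Mod kernel G A f"
    using f.FactGroup_iso[OF assms(3)] group.iso_sym normal.factorgroup_is_group f.normal_kernel by blast
  ultimately show ?thesis by (rule iso_trans[rotated])
qed

text \<open>The map factors through \<open>G Mod N\<close>, and homomorphisms send
  \<open>\<gamma>\<^sub>k\<close> into \<open>\<gamma>\<^sub>k\<close> of the target, which is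
  trivial here.\<close>

lemma (in group_hom) nilpotent_kills:
  assumes "N \<lhd> G" "\<And>x. x \<in> N \<Longrightarrow> h x = \<one>\<^bsub>H\<^esub>"
    and "lower_central H k = {\<one>\<^bsub>H\<^esub>}"
    and "w \<in> carrier G" "N #> w \<in> lower_central (G Mod N) k"
  shows "h w = \<one>\<^bsub>H\<^esub>"
proof -
  have "N \<subseteq> kernel G H h"
    using assms(2) subgroup.mem_carrier[OF normal_imp_subgroup[OF assms(1)]] by (auto simp: kernel_def)
  then obtain g where g: "g \<in> hom (G Mod N) H" "\<And>x. x \<in> carrier G \<Longrightarrow> g (N #> x) = h x"
    using FactGroup_universal_kernel[OF assms(1)] by blast
  interpret g: group_hom "G Mod N" H g
    using g(1) assms(1) by (simp add: group_hom_def group_hom_axioms_def normal.factorgroup_is_group)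
  show ?thesis
    using g.hom_lower_central[OF assms(5)] assms(3,4) g(2) by simp
qed

definition nilpotent_residual :: "('a, 'b) monoid_scheme \<Rightarrow> 'a set" where
  "nilpotent_residual G = (\<Inter>k\<in>{1..}. lower_central G k)"

context group
begin

lemma normal_nilpotent_residual: "nilpotent_residual G \<lhd> G"
proof (rule normal_invI)
  show "subgroup (nilpotent_residual G) G"
    unfolding nilpotent_residual_def
    by (intro subgroups_Inter) (auto intro: subgroup_lower_central)
  show "x \<otimes> h \<otimes> inv x \<in> nilpotent_residual G" if "x \<in> carrier G" "h \<in> nilpotent_residual G" for x h
    using that normal_invE(2)[OF normal_lower_central] by (auto simp: nilpotent_residual_def)
qed

text \<open>The residual lies inside every \<open>\<gamma>\<^sub>k\<close>, so changing a
  representative by an element of it does not affect membership.\<close>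

lemma lower_central_Mod_residual_iff:
  assumes "1 \<le> k" "x \<in> carrier G"
  shows "nilpotent_residual G #> x \<in> lower_central (G Mod nilpotent_residual G) k \<longleftrightarrow> x \<in> lower_central G k"
proof
  let ?R = "nilpotent_residual G"
  assume "?R #> x \<in> lower_central (G Mod ?R) k"
  then obtain c where c: "c \<in> lower_central G k" "?R #> x = ?R #> c"
    using lower_central_Mod[OF normal_nilpotent_residual] by auto
  have cc: "c \<in> carrier G" using c lower_central_closed by blast
  have "x \<otimes> inv c \<in> lower_central G k"
    using c cc assms coset_eq_iff[OF normal_nilpotent_residual] by (auto simp: nilpotent_residual_def)
  then have "x \<otimes> inv c \<otimes> c \<in> lower_central G k"
    using c subgroup.m_closed[OF subgroup_lower_central] by blast
  then show "x \<in> lower_central G k" using assms cc by (simp add: m_assoc)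
next
  assume "x \<in> lower_central G k"
  then show "nilpotent_residual G #> x \<in> lower_central (G Mod nilpotent_residual G) k"
    using lower_central_Mod[OF normal_nilpotent_residual] by blast
qed

lemma residually_nilpotent_Mod_residual: "residually_nilpotent (G Mod nilpotent_residual G)"
proof -
  let ?R = "nilpotent_residual G"
  interpret H: group "G Mod ?R"
    using normal.factorgroup_is_group normal_nilpotent_residual by blast
  have "y = \<one>\<^bsub>G Mod ?R\<^esub>" if y: "\<And>k. 1 \<le> k \<Longrightarrow> y \<in> lower_central (G Mod ?R) k" for y
  proof -
    have "y \<in> carrier (G Mod ?R)" using y[of 1] by simp
    then obtain x where x: "x \<in> carrier G" "y = ?R #> x" by (auto simp: carrier_FactGroup)
    then have "x \<in> ?R"
      using y lower_central_Mod_residual_iff by (auto simp: nilpotent_residual_def)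
    then show ?thesis using x coset_eq_one_iff normal_nilpotent_residual by blast
  qed
  then show ?thesis
    using subgroup.one_closed[OF H.subgroup_lower_central] by (auto simp: residually_nilpotent_def)
qed

text \<open>Both sides are images of \<open>G\<close>, and by
  \<open>lower_central_Mod_residual_iff\<close> both kernels equal
  \<open>\<gamma>\<^sub>k\<close>.\<close>

lemma Mod_residual_Mod_lower_central:
  assumes "1 \<le> k"
  shows "(G Mod nilpotent_residual G) Mod lower_central (G Mod nilpotent_residual G) k \<cong> G Mod lower_central G k"
proof -
  let ?R = "nilpotent_residual G"
  let ?H = "G Mod ?R"
  interpret H: group ?H
    using normal.factorgroup_is_group normal_nilpotent_residual by blast
  interpret r: group_hom G ?H "\<lambda>x. ?R #> x"
    by (rule group_hom_Mod) (rule normal_nilpotent_residual)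
  interpret s: group_hom ?H "?H Mod lower_central ?H k" "\<lambda>x. lower_central ?H k #>\<^bsub>?H\<^esub> x"
    by (rule H.group_hom_Mod) (rule H.normal_lower_central)
  show ?thesis
  proof (rule iso_of_same_kernel)
    show "group_hom G (?H Mod lower_central ?H k) (\<lambda>x. lower_central ?H k #>\<^bsub>?H\<^esub> (?R #> x))"
      using group_hom_comp r.group_hom_axioms s.group_hom_axioms by fast
    show "group_hom G (G Mod lower_central G k) (\<lambda>x. lower_central G k #> x)"
      by (rule group_hom_Mod) (rule normal_lower_central)
    show "(\<lambda>x. lower_central ?H k #>\<^bsub>?H\<^esub> (?R #> x)) ` carrier G = carrier (?H Mod lower_central ?H k)"
      by (simp add: carrier_FactGroup image_image)
    show "(\<lambda>x. lower_central G k #> x) ` carrier G = carrier (G Mod lower_central G k)"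
      by (simp add: carrier_FactGroup)
    show "lower_central ?H k #>\<^bsub>?H\<^esub> (?R #> x) = \<one>\<^bsub>?H Mod lower_central ?H k\<^esub> \<longleftrightarrow>
        lower_central G k #> x = \<one>\<^bsub>G Mod lower_central G k\<^esub>" if "x \<in> carrier G" for x
      using that coset_eq_one_iff[OF normal_lower_central that] H.coset_eq_one_iff[OF H.normal_lower_central r.hom_closed[OF that]]
        lower_central_Mod_residual_iff[OF assms that] by simp
  qed
qed

end

section \<open>Endomorphisms of free groups that are trivial on the abelianisation\<close>

lemma (in group_hom) hom_eq_of_coset_eq:
  assumes "lower_central H k = {\<one>\<^bsub>H\<^esub>}" "x \<in> carrier G" "y \<in> carrier G"
    and "lower_central G k #> x = lower_central G k #> y"
  shows "h x = h y"
proof -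
  have "x \<otimes> inv y \<in> lower_central G k"
    using assms G.coset_eq_iff G.normal_lower_central by blast
  then have "h (x \<otimes> inv y) = \<one>\<^bsub>H\<^esub>"
    using hom_lower_central assms(1) by blast
  then have "h x \<otimes>\<^bsub>H\<^esub> inv\<^bsub>H\<^esub> h y = \<one>\<^bsub>H\<^esub>"
    using assms by simp
  then show ?thesis
    using assms H.inv_equality by fastforce
qed

lemma (in group_hom) hom_coset_eq:
  assumes "x \<in> carrier G" "y \<in> carrier G"
    and "lower_central G k #> x = lower_central G k #> y"
  shows "lower_central H k #>\<^bsub>H\<^esub> h x = lower_central H k #>\<^bsub>H\<^esub> h y"
proof -
  interpret q: group_hom H "H Mod lower_central H k" "\<lambda>x. lower_central H k #>\<^bsub>H\<^esub> x"
    by (rule H.group_hom_Mod) (rule H.normal_lower_central)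
  interpret qh: group_hom G "H Mod lower_central H k" "\<lambda>x. lower_central H k #>\<^bsub>H\<^esub> h x"
    by (rule group_hom_comp[OF group_hom_axioms q.group_hom_axioms])
  show ?thesis
    by (rule qh.hom_eq_of_coset_eq[OF H.lower_central_Mod_lower_central assms])
qed

text \<open>Named after IA automorphisms, which act as the identity on the abelianisation. A
  condition on generators suffices, as \<open>free_coset_eqI\<close> extends it to all
  words.\<close>

definition ia_endo :: "(('a \<times> bool) list \<Rightarrow> ('a \<times> bool) list) \<Rightarrow> bool" where
  "ia_endo \<phi> \<longleftrightarrow> \<phi> \<in> hom free_group free_group \<and>
     (\<forall>c. lower_central free_group 2 #>\<^bsub>free_group\<^esub> \<phi> (free_gen c)
        = lower_central free_group 2 #>\<^bsub>free_group\<^esub> free_gen c)"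

lemma group_hom_free_endo:
  "\<phi> \<in> hom free_group free_group \<Longrightarrow> group_hom free_group free_group \<phi>"
  by (simp add: group_hom_def group_hom_axioms_def group_free_group)

lemma free_coset_eqI:
  fixes \<phi> :: "('a \<times> bool) list \<Rightarrow> ('b \<times> bool) list"
  assumes "\<phi> \<in> hom free_group free_group" "\<psi> \<in> hom free_group free_group" "N \<lhd> free_group"
    and "\<And>c. N #>\<^bsub>free_group\<^esub> \<phi> (free_gen c) = N #>\<^bsub>free_group\<^esub> \<psi> (free_gen c)"
    and "w \<in> carrier free_group"
  shows "N #>\<^bsub>free_group\<^esub> \<phi> w = N #>\<^bsub>free_group\<^esub> \<psi> w"
proof -
  interpret q: group_hom free_group "free_group Mod N" "\<lambda>w. N #>\<^bsub>free_group\<^esub> w"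
    using F.group_hom_Mod assms(3) .
  have "(\<lambda>w. N #>\<^bsub>free_group\<^esub> \<phi> w) \<in> hom free_group (free_group Mod N)"
       "(\<lambda>w. N #>\<^bsub>free_group\<^esub> \<psi> w) \<in> hom free_group (free_group Mod N)"
    using hom_compose[OF assms(1) q.homh] hom_compose[OF assms(2) q.homh] by (simp_all add: comp_def)
  then show ?thesis
    using q.H.free_hom_eqI assms(4,5) by blast
qed

text \<open>The image of \<phi> covers the quotient by \<open>\<gamma>\<^sub>2\<close>, hence the
  one by \<open>\<gamma>\<^sub>k\<close>. So each generator has a preimage modulo
  \<open>\<gamma>\<^sub>k\<close>, and \<psi> sends generators to such preimages. That \<psi> is
  again of the same kind lets the lemma be applied to \<psi> itself.\<close>

lemma ia_endo_right_inverse: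
  assumes \<phi>: "ia_endo \<phi>" and "2 \<le> k"
  obtains \<psi> where "ia_endo \<psi>"
    "\<And>w. w \<in> carrier free_group \<Longrightarrow>
      lower_central free_group k #>\<^bsub>free_group\<^esub> \<phi> (\<psi> w) = lower_central free_group k #>\<^bsub>free_group\<^esub> w"
proof -
  interpret \<phi>: group_hom free_group free_group \<phi>
    using \<phi> group_hom_free_endo by (auto simp: ia_endo_def)
  have id: "(\<lambda>w. w) \<in> hom free_group free_group" by (auto intro: homI)
  have \<phi>2: "lower_central free_group 2 #>\<^bsub>free_group\<^esub> \<phi> w = lower_central free_group 2 #>\<^bsub>free_group\<^esub> w"
    if "w \<in> carrier free_group" for w
    using free_coset_eqI[OF \<phi>.homh id F.normal_lower_central _ that] \<phi> by (simp add: ia_endo_def)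
  have "\<exists>s\<in>\<phi> ` carrier free_group. lower_central free_group k #>\<^bsub>free_group\<^esub> g = lower_central free_group k #>\<^bsub>free_group\<^esub> s"
    if "g \<in> carrier free_group" for g
    by (rule F.subgroup_covers_lower_central_quotients[OF \<phi>.img_is_subgroup _ that])
      (use \<phi>2 in blast)
  then have "\<forall>c. \<exists>t\<in>carrier free_group.
      lower_central free_group k #>\<^bsub>free_group\<^esub> \<phi> t = lower_central free_group k #>\<^bsub>free_group\<^esub> free_gen c"
    by (metis free_gen_closed imageE)
  then obtain t where t: "\<And>c. t c \<in> carrier free_group"
      "\<And>c. lower_central free_group k #>\<^bsub>free_group\<^esub> \<phi> (t c) = lower_central free_group k #>\<^bsub>free_group\<^esub> free_gen c"
    by metis
  then have rt: "range t \<subseteq> carrier free_group" by blast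
  interpret \<psi>: group_hom free_group free_group "free_lift free_group t"
    using group_hom_free_endo F.free_lift_hom[OF rt] .
  have \<phi>\<psi>: "lower_central free_group k #>\<^bsub>free_group\<^esub> \<phi> (free_lift free_group t w) = lower_central free_group k #>\<^bsub>free_group\<^esub> w"
    if "w \<in> carrier free_group" for w
  proof (rule free_coset_eqI[OF _ id F.normal_lower_central _ that])
    show "(\<lambda>w. \<phi> (free_lift free_group t w)) \<in> hom free_group free_group"
      using hom_compose[OF \<psi>.homh \<phi>.homh] by (simp add: comp_def)
  qed (simp add: F.free_lift_gen[OF rt] t)
  \<comment> \<open>Modulo \<open>\<gamma>\<^sub>2\<close> the element \<open>\<phi> (t c)\<close>
    equals \<open>t c\<close>, because \<phi> acts trivially there, and it equals the generator,
    because \<open>2 \<le> k\<close>.\<close>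
  have "lower_central free_group 2 #>\<^bsub>free_group\<^esub> t c = lower_central free_group 2 #>\<^bsub>free_group\<^esub> free_gen c" for c
  proof -
    have "\<phi> (t c) \<otimes>\<^bsub>free_group\<^esub> inv\<^bsub>free_group\<^esub> free_gen c \<in> lower_central free_group k"
      using F.coset_eq_iff[OF F.normal_lower_central, of "\<phi> (t c)" "free_gen c" k] t by simp
    then have "\<phi> (t c) \<otimes>\<^bsub>free_group\<^esub> inv\<^bsub>free_group\<^esub> free_gen c \<in> lower_central free_group 2"
      using F.lower_central_antimono[OF \<open>2 \<le> k\<close>] by blast
    then show ?thesis
      using F.coset_eq_iff[OF F.normal_lower_central, of "\<phi> (t c)" "free_gen c" 2] t \<phi>2 by simp
  qed
  then have "ia_endo (free_lift free_group t)"
    by (simp add: ia_endo_def F.free_lift_gen[OF rt] \<psi>.homh)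
  then show ?thesis using that \<phi>\<psi> by blast
qed

text \<open>If \<open>\<phi> \<circ> \<psi>\<close> and \<open>\<psi> \<circ> \<phi>'\<close> are the identity modulo \<open>\<gamma>\<^sub>k\<close>, then \<open>\<phi>\<close> and \<open>\<phi>'\<close> agree
  modulo \<open>\<gamma>\<^sub>k\<close>.\<close>

lemma ia_endo_inverse:
  assumes \<phi>: "ia_endo \<phi>"
  obtains \<psi> where "\<psi> \<in> hom free_group free_group"
    "\<And>w. w \<in> carrier free_group \<Longrightarrow>
      lower_central free_group k #>\<^bsub>free_group\<^esub> \<phi> (\<psi> w) = lower_central free_group k #>\<^bsub>free_group\<^esub> w"
    "\<And>w. w \<in> carrier free_group \<Longrightarrow>
      lower_central free_group k #>\<^bsub>free_group\<^esub> \<psi> (\<phi> w) = lower_central free_group k #>\<^bsub>free_group\<^esub> w"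
proof -
  \<comment> \<open>One-sided inverses are available only from level 2 on; the result is carried
    down to level \<open>k\<close> afterwards.\<close>
  define m where "m = max 2 k"
  define q where "q = (\<lambda>w::('a \<times> bool) list. lower_central free_group m #>\<^bsub>free_group\<^esub> w)"
  have "2 \<le> m" by (simp add: m_def)
  obtain \<psi> where \<psi>: "ia_endo \<psi>" and \<phi>\<psi>: "\<And>w. w \<in> carrier free_group \<Longrightarrow> q (\<phi> (\<psi> w)) = q w"
    using ia_endo_right_inverse[OF \<phi> \<open>2 \<le> m\<close>] unfolding q_def by blast
  obtain \<phi>' where \<phi>': "ia_endo \<phi>'" and \<psi>\<phi>': "\<And>w. w \<in> carrier free_group \<Longrightarrow> q (\<psi> (\<phi>' w)) = q w"
    using ia_endo_right_inverse[OF \<psi> \<open>2 \<le> m\<close>] unfolding q_def by blast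
  interpret \<phi>: group_hom free_group free_group \<phi>
    using \<phi> group_hom_free_endo by (auto simp: ia_endo_def)
  interpret \<psi>: group_hom free_group free_group \<psi>
    using \<psi> group_hom_free_endo by (auto simp: ia_endo_def)
  interpret \<phi>': group_hom free_group free_group \<phi>'
    using \<phi>' group_hom_free_endo by (auto simp: ia_endo_def)
  have \<psi>\<phi>: "q (\<psi> (\<phi> w)) = q w" if w: "w \<in> carrier free_group" for w
  proof -
    have "q (\<phi> (\<psi> (\<phi>' w))) = q (\<phi> w)"
      using \<phi>.hom_coset_eq[OF _ w \<psi>\<phi>'[OF w, unfolded q_def]] w by (simp add: q_def)
    then have "q (\<phi> w) = q (\<phi>' w)"
      using \<phi>\<psi>[of "\<phi>' w"] w by simp
    then have "q (\<psi> (\<phi> w)) = q (\<psi> (\<phi>' w))"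
      using \<psi>.hom_coset_eq[of "\<phi> w" "\<phi>' w" m] w by (simp add: q_def)
    then show ?thesis using \<psi>\<phi>'[OF w] by simp
  qed
  have descend: "lower_central free_group k #>\<^bsub>free_group\<^esub> x = lower_central free_group k #>\<^bsub>free_group\<^esub> y"
    if "q x = q y" "x \<in> carrier free_group" "y \<in> carrier free_group" for x y :: "('a \<times> bool) list"
  proof -
    have "k \<le> m" by (simp add: m_def)
    then show ?thesis
      using that(1) F.coset_eq_iff[OF F.normal_lower_central that(2,3)]
        subsetD[OF F.lower_central_antimono[OF \<open>k \<le> m\<close>]]
      unfolding q_def by metis
  qed
  show ?thesis
  proof (rule that[OF \<psi>.homh])
    fix w :: "('a \<times> bool) list"
    assume w: "w \<in> carrier free_group"
    show "lower_central free_group k #>\<^bsub>free_group\<^esub> \<phi> (\<psi> w) = lower_central free_group k #>\<^bsub>free_group\<^esub> w"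
      by (rule descend[OF \<phi>\<psi>[OF w]]) (simp_all add: w)
    show "lower_central free_group k #>\<^bsub>free_group\<^esub> \<psi> (\<phi> w) = lower_central free_group k #>\<^bsub>free_group\<^esub> w"
      by (rule descend[OF \<psi>\<phi>[OF w]]) (simp_all add: w)
  qed
qed

text \<open>Composing the projection \<open>f\<close> with \<phi> kills \<open>K\<close>, and
  composing \<open>g\<close> with \<psi> kills \<open>N\<close>. As \<phi> and \<psi> are mutually
  inverse modulo \<open>\<gamma>\<^sub>k\<close>, the maps \<open>f\<close> and \<open>g\<close>
  after \<psi> are surjections from the free group with the same kernel.\<close>

lemma Mod_normal_closure_ia_endo:
  fixes S :: "('a \<times> bool) list set"
  assumes \<phi>: "ia_endo \<phi>" and S: "S \<subseteq> carrier free_group"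
  defines "K \<equiv> normal_closure free_group S" and "N \<equiv> normal_closure free_group (\<phi> ` S)"
  shows "(free_group Mod N) Mod lower_central (free_group Mod N) k
      \<cong> (free_group Mod K) Mod lower_central (free_group Mod K) k"
proof -
  interpret \<phi>: group_hom free_group free_group \<phi>
    using \<phi> group_hom_free_endo by (auto simp: ia_endo_def)
  obtain \<psi> where "\<psi> \<in> hom free_group free_group" and \<phi>\<psi>: "\<And>w. w \<in> carrier free_group \<Longrightarrow>
      lower_central free_group k #>\<^bsub>free_group\<^esub> \<phi> (\<psi> w) = lower_central free_group k #>\<^bsub>free_group\<^esub> w"
    and \<psi>\<phi>: "\<And>w. w \<in> carrier free_group \<Longrightarrow>
      lower_central free_group k #>\<^bsub>free_group\<^esub> \<psi> (\<phi> w) = lower_central free_group k #>\<^bsub>free_group\<^esub> w"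
    using ia_endo_inverse[OF \<phi>] by metis
  then interpret \<psi>: group_hom free_group free_group \<psi>
    using group_hom_free_endo by blast
  have \<phi>S: "\<phi> ` S \<subseteq> carrier free_group" using S by auto
  have N: "N \<lhd> free_group" and K: "K \<lhd> free_group"
    unfolding N_def K_def using F.normal_normal_closure S \<phi>S by blast+
  \<comment> \<open>Stated for an arbitrary normal subgroup so that it serves both \<open>N\<close>
    and \<open>K\<close>.\<close>
  have *: "group_hom free_group ((free_group Mod M) Mod lower_central (free_group Mod M) k)
         (\<lambda>w. lower_central (free_group Mod M) k #>\<^bsub>free_group Mod M\<^esub> (M #>\<^bsub>free_group\<^esub> w))"
    and lc1: "lower_central ((free_group Mod M) Mod lower_central (free_group Mod M) k) k = {\<one>\<^bsub>(free_group Mod M) Mod lower_central (free_group Mod M) k\<^esub>}"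
    and one_iff: "\<And>w. w \<in> carrier free_group \<Longrightarrow> lower_central (free_group Mod M) k #>\<^bsub>free_group Mod M\<^esub> (M #>\<^bsub>free_group\<^esub> w) = \<one>\<^bsub>(free_group Mod M) Mod lower_central (free_group Mod M) k\<^esub>
      \<longleftrightarrow> M #>\<^bsub>free_group\<^esub> w \<in> lower_central (free_group Mod M) k"
    if M: "M \<lhd> free_group" for M :: "('a \<times> bool) list set"
  proof -
    interpret q: group_hom free_group "free_group Mod M" "\<lambda>w. M #>\<^bsub>free_group\<^esub> w"
      by (rule F.group_hom_Mod[OF M])
    show "group_hom free_group ((free_group Mod M) Mod lower_central (free_group Mod M) k)
         (\<lambda>w. lower_central (free_group Mod M) k #>\<^bsub>free_group Mod M\<^esub> (M #>\<^bsub>free_group\<^esub> w))"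
      by (rule group_hom_comp[OF q.group_hom_axioms q.H.group_hom_Mod[OF q.H.normal_lower_central]])
    show "lower_central ((free_group Mod M) Mod lower_central (free_group Mod M) k) k = {\<one>\<^bsub>(free_group Mod M) Mod lower_central (free_group Mod M) k\<^esub>}"
      by (rule q.H.lower_central_Mod_lower_central)
    show "lower_central (free_group Mod M) k #>\<^bsub>free_group Mod M\<^esub> (M #>\<^bsub>free_group\<^esub> w) = \<one>\<^bsub>(free_group Mod M) Mod lower_central (free_group Mod M) k\<^esub>
      \<longleftrightarrow> M #>\<^bsub>free_group\<^esub> w \<in> lower_central (free_group Mod M) k" if "w \<in> carrier free_group" for w
      by (rule q.H.coset_eq_one_iff[OF q.H.normal_lower_central q.hom_closed[OF that]])
  qed
  define QN where "QN = (free_group Mod N) Mod lower_central (free_group Mod N) k"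
  define QK where "QK = (free_group Mod K) Mod lower_central (free_group Mod K) k"
  define f where "f w = lower_central (free_group Mod N) k #>\<^bsub>free_group Mod N\<^esub> (N #>\<^bsub>free_group\<^esub> w)" for w
  define g where "g w = lower_central (free_group Mod K) k #>\<^bsub>free_group Mod K\<^esub> (K #>\<^bsub>free_group\<^esub> w)" for w
  interpret f: group_hom free_group QN f
    unfolding QN_def f_def by (rule *[OF N])
  interpret g: group_hom free_group QK g
    unfolding QK_def g_def by (rule *[OF K])
  interpret f\<phi>: group_hom free_group QN "\<lambda>w. f (\<phi> w)"
    by (rule group_hom_comp[OF \<phi>.group_hom_axioms f.group_hom_axioms])
  interpret g\<psi>: group_hom free_group QK "\<lambda>w. g (\<psi> w)"
    by (rule group_hom_comp[OF \<psi>.group_hom_axioms g.group_hom_axioms])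
  have lcN: "lower_central QN k = {\<one>\<^bsub>QN\<^esub>}" and lcK: "lower_central QK k = {\<one>\<^bsub>QK\<^esub>}"
    unfolding QN_def QK_def using lc1 N K by blast+
  have f_one: "f w = \<one>\<^bsub>QN\<^esub> \<longleftrightarrow> N #>\<^bsub>free_group\<^esub> w \<in> lower_central (free_group Mod N) k"
   and g_one: "g w = \<one>\<^bsub>QK\<^esub> \<longleftrightarrow> K #>\<^bsub>free_group\<^esub> w \<in> lower_central (free_group Mod K) k"
    if "w \<in> carrier free_group" for w
    unfolding f_def g_def QN_def QK_def using one_iff N K that by blast+
  have f_kills: "f w = \<one>\<^bsub>QN\<^esub>" if "w \<in> N" for w
  proof -
    have w: "w \<in> carrier free_group" using that N normal_imp_subgroup subgroup.mem_carrier by metis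
    then have "N #>\<^bsub>free_group\<^esub> w = \<one>\<^bsub>free_group Mod N\<^esub>" using F.coset_eq_one_iff[OF N] that by blast
    then show ?thesis
      using f_one[OF w] group.subgroup_lower_central[of "free_group Mod N"] subgroup.one_closed
        normal.factorgroup_is_group[OF N] by metis
  qed
  have g_kills: "g w = \<one>\<^bsub>QK\<^esub>" if "w \<in> K" for w
  proof -
    have w: "w \<in> carrier free_group" using that K normal_imp_subgroup subgroup.mem_carrier by metis
    then have "K #>\<^bsub>free_group\<^esub> w = \<one>\<^bsub>free_group Mod K\<^esub>" using F.coset_eq_one_iff[OF K] that by blast
    then show ?thesis
      using g_one[OF w] group.subgroup_lower_central[of "free_group Mod K"] subgroup.one_closed
        normal.factorgroup_is_group[OF K] by metis
  qed
  have f\<phi>\<psi>: "f (\<phi> (\<psi> w)) = f w" and g\<psi>\<phi>: "g (\<psi> (\<phi> w)) = g w" if "w \<in> carrier free_group" for w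
    using f.hom_eq_of_coset_eq[OF lcN _ _ \<phi>\<psi>] g.hom_eq_of_coset_eq[OF lcK _ _ \<psi>\<phi>] that by simp_all
  have KN: "N \<subseteq> kernel free_group QK (\<lambda>w. g (\<psi> w))" 
    unfolding N_def
  proof (rule F.normal_closure_minimal[OF g\<psi>.normal_kernel], clarify)
    fix s assume s: "s \<in> S"
    then have "g (\<psi> (\<phi> s)) = \<one>\<^bsub>QK\<^esub>"
      using g\<psi>\<phi> g_kills F.normal_closure_incl[OF S] S unfolding K_def by auto
    then show "\<phi> s \<in> kernel free_group QK (\<lambda>w. g (\<psi> w))"
      using s S by (auto simp: kernel_def)
  qed
  have NK: "K \<subseteq> kernel free_group QN (\<lambda>w. f (\<phi> w))"
    unfolding K_def
  proof (rule F.normal_closure_minimal[OF f\<phi>.normal_kernel], clarify)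
    fix s assume s: "s \<in> S"
    then show "s \<in> kernel free_group QN (\<lambda>w. f (\<phi> w))"
      using S f_kills F.normal_closure_incl[OF \<phi>S] unfolding N_def by (auto simp: kernel_def)
  qed
  have "QN \<cong> QK"
  proof (rule iso_of_same_kernel)
    show "group_hom free_group QN f" "group_hom free_group QK (\<lambda>w. g (\<psi> w))"
      by (fact f.group_hom_axioms g\<psi>.group_hom_axioms)+
    show "f ` carrier free_group = carrier QN"
      by (simp add: f_def QN_def carrier_FactGroup image_image)
    have surj: "g ` carrier free_group = carrier QK"
      by (simp add: g_def QK_def carrier_FactGroup image_image)
    \<comment> \<open>Surjectivity of \<open>g\<close> after \<psi>: the value \<open>g w\<close> is
      attained at \<open>\<phi> w\<close>.\<close>
    have "g w \<in> (\<lambda>w. g (\<psi> w)) ` carrier free_group" if "w \<in> carrier free_group" for w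
      using imageI[OF \<phi>.hom_closed[OF that], of "\<lambda>w. g (\<psi> w)"] g\<psi>\<phi>[OF that] by simp
    then have "carrier QK \<subseteq> (\<lambda>w. g (\<psi> w)) ` carrier free_group"
      unfolding surj[symmetric] by (rule image_subsetI)
    then show "(\<lambda>w. g (\<psi> w)) ` carrier free_group = carrier QK"
      using image_subsetI[OF g\<psi>.hom_closed] by (rule subset_antisym[rotated])
    show "f w = \<one>\<^bsub>QN\<^esub> \<longleftrightarrow> g (\<psi> w) = \<one>\<^bsub>QK\<^esub>" if w: "w \<in> carrier free_group" for w
    proof
      assume "f w = \<one>\<^bsub>QN\<^esub>"
      then show "g (\<psi> w) = \<one>\<^bsub>QK\<^esub>"
        using g\<psi>.nilpotent_kills[OF N _ lcK w] f_one[OF w] KN by (auto simp: kernel_def)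
    next
      assume "g (\<psi> w) = \<one>\<^bsub>QK\<^esub>"
      then have "f (\<phi> (\<psi> w)) = \<one>\<^bsub>QN\<^esub>"
        using f\<phi>.nilpotent_kills[OF K _ lcN \<psi>.hom_closed[OF w]] g_one \<psi>.hom_closed[OF w] NK
        by (auto simp: kernel_def)
      then show "f w = \<one>\<^bsub>QN\<^esub>" using f\<phi>\<psi> w by simp
    qed
  qed
  then show ?thesis unfolding QN_def QK_def .
qed

text \<open>Homomorphisms from a free group are encoded by their values on the generators. A finite
  nilpotent group admits equally many homomorphisms from the presentations with relators \<open>S\<close> and
  \<open>\<phi> ` S\<close>; hence an injection between these finite sets is onto.\<close>

lemma (in group) finite_nilpotent_hom_kills_image:
  fixes S :: "('c::finite \<times> bool) list set"
  assumes fin: "finite (carrier G)" and nil: "lower_central G k = {\<one>}"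
    and \<phi>: "ia_endo \<phi>" and S: "S \<subseteq> carrier free_group"
  defines "N \<equiv> normal_closure free_group (\<phi> ` S)"
  assumes \<theta>: "\<theta> \<in> iso free_group free_group"
    and sub: "normal_closure free_group S \<subseteq>
      \<theta> ` {w \<in> carrier free_group. N #>\<^bsub>free_group\<^esub> w \<in> lower_central (free_group Mod N) k}"
    and g: "range g \<subseteq> carrier G" "\<And>s. s \<in> S \<Longrightarrow> free_lift G g s = \<one>"
    and w: "w \<in> carrier free_group" "N #>\<^bsub>free_group\<^esub> w \<in> lower_central (free_group Mod N) k"
  shows "free_lift G g (\<theta> w) = \<one>"
proof -
  interpret \<phi>: group_hom free_group free_group \<phi>
    using \<phi> group_hom_free_endo by (auto simp: ia_endo_def)
  obtain \<psi> where "\<psi> \<in> hom free_group free_group" and \<psi>\<phi>: "\<And>w. w \<in> carrier free_group \<Longrightarrow>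
      lower_central free_group k #>\<^bsub>free_group\<^esub> \<psi> (\<phi> w) = lower_central free_group k #>\<^bsub>free_group\<^esub> w"
    using ia_endo_inverse[OF \<phi>] by metis
  then interpret \<psi>: group_hom free_group free_group \<psi>
    using group_hom_free_endo by blast
  define \<theta>' where "\<theta>' = inv_into (carrier free_group) \<theta>"
  have "\<theta>' \<in> iso free_group free_group"
    unfolding \<theta>'_def using F.iso_set_sym \<theta> by blast
  then interpret \<theta>': group_hom free_group free_group \<theta>'
    using group_hom_free_endo by (auto simp: iso_def)
  interpret \<theta>: group_hom free_group free_group \<theta>
    using \<theta> group_hom_free_endo by (auto simp: iso_def)
  have \<theta>'\<theta>: "\<theta>' (\<theta> u) = u" and \<theta>\<theta>': "\<theta> (\<theta>' u) = u" if "u \<in> carrier free_group" for u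
    unfolding \<theta>'_def using \<theta> that
    by (auto simp: iso_def bij_betw_def f_inv_into_f)
  have \<phi>S: "\<phi> ` S \<subseteq> carrier free_group" using S by auto
  have N: "N \<lhd> free_group"
    unfolding N_def by (rule F.normal_normal_closure[OF \<phi>S])
  \<comment> \<open>Homomorphisms from the group presented by \<open>T\<close>, encoded by their
    values on the generators; this makes them a finite set.\<close>
  define Hom where "Hom T = {f::'c \<Rightarrow> 'a. range f \<subseteq> carrier G \<and> (\<forall>s\<in>T. free_lift G f s = \<one>)}" for T
  have finHom: "finite (Hom T)" for T
    using finite_set_of_finite_funs[OF finite_UNIV fin]
    by (rule rev_finite_subset) (auto simp: Hom_def)
  \<comment> \<open>Precomposition with an endomorphism of the free group, in the same
    encoding.\<close>
  define pre where "pre \<alpha> f = (\<lambda>c::'c. free_lift G f (\<alpha> (free_gen c)))" for \<alpha> :: "('c \<times> bool) list \<Rightarrow> ('c \<times> bool) list" and f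
  have pre_range: "range (pre \<alpha> f) \<subseteq> carrier G" if "range f \<subseteq> carrier G" for \<alpha> f
    using that by (auto simp: pre_def free_lift_closed)
  have pre: "free_lift G (pre \<alpha> f) u = free_lift G f (\<alpha> u)"
    if f: "range f \<subseteq> carrier G" and \<alpha>: "\<alpha> \<in> hom free_group free_group" and "u \<in> carrier free_group" for f \<alpha> u
  proof (rule free_hom_eqI[OF free_lift_hom[OF pre_range[OF f]] _ _ that(3)])
    show "(\<lambda>u. free_lift G f (\<alpha> u)) \<in> hom free_group G"
      using Group.hom_compose[OF \<alpha> free_lift_hom[OF f]] by (simp add: comp_def)
    show "free_lift G (pre \<alpha> f) (free_gen c) = free_lift G f (\<alpha> (free_gen c))" for c
      unfolding free_lift_gen[OF pre_range[OF f]] by (simp add: pre_def)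
  qed
  have lift: "group_hom free_group G (free_lift G f)" if "range f \<subseteq> carrier G" for f :: "'c \<Rightarrow> 'a"
    using free_lift_hom[OF that] by (simp add: group_hom_def group_hom_axioms_def group_free_group is_group)
  have "Hom S \<subseteq> pre \<phi> ` Hom (\<phi> ` S)"
  proof
    fix f
    assume f: "f \<in> Hom S"
    then have rf: "range f \<subseteq> carrier G" by (simp add: Hom_def)
    interpret f: group_hom free_group G "free_lift G f" by (rule lift[OF rf])
    have f\<psi>\<phi>: "free_lift G f (\<psi> (\<phi> u)) = free_lift G f u" if "u \<in> carrier free_group" for u
      using f.hom_eq_of_coset_eq[OF nil _ _ \<psi>\<phi>] that by simp
    have "pre \<psi> f \<in> Hom (\<phi> ` S)"
      using f f\<psi>\<phi> S pre_range[OF rf] pre[OF rf \<psi>.homh] by (auto simp: Hom_def subset_iff)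
    moreover have "pre \<phi> (pre \<psi> f) = f"
      using f\<psi>\<phi> pre[OF rf \<psi>.homh] free_lift_gen[OF rf] by (auto simp: pre_def[of \<phi>])
    ultimately show "f \<in> pre \<phi> ` Hom (\<phi> ` S)" by (metis imageI)
  qed
  then have "card (Hom S) \<le> card (pre \<phi> ` Hom (\<phi> ` S))"
    using finHom by (intro card_mono) auto
  also have "\<dots> \<le> card (Hom (\<phi> ` S))"
    using finHom by (rule card_image_le)
  also have "\<dots> = card (pre \<theta>' ` Hom (\<phi> ` S))"
  proof (rule card_image[symmetric], rule inj_on_inverseI)
    fix f
    assume "f \<in> Hom (\<phi> ` S)"
    then have rf: "range f \<subseteq> carrier G" by (simp add: Hom_def)
    show "pre \<theta> (pre \<theta>' f) = f"
      using \<theta>'\<theta> pre[OF rf \<theta>'.homh] free_lift_gen[OF rf] by (auto simp: pre_def[of \<theta>])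
  qed
  finally have card: "card (Hom S) \<le> card (pre \<theta>' ` Hom (\<phi> ` S))" .
  have kills: "free_lift G f u = \<one>"
    if f: "f \<in> Hom (\<phi> ` S)" and u: "u \<in> carrier free_group" "N #>\<^bsub>free_group\<^esub> u \<in> lower_central (free_group Mod N) k" for f u
  proof -
    have rf: "range f \<subseteq> carrier G" using f by (simp add: Hom_def)
    interpret f: group_hom free_group G "free_lift G f" by (rule lift[OF rf])
    have "\<phi> ` S \<subseteq> kernel free_group G (free_lift G f)"
      using f \<phi>S by (auto simp: Hom_def kernel_def)
    then have "N \<subseteq> kernel free_group G (free_lift G f)"
      unfolding N_def using F.normal_closure_minimal f.normal_kernel by blast
    then show ?thesis
      using f.nilpotent_kills[OF N _ nil u] by (auto simp: kernel_def)
  qed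
  \<comment> \<open>By \<open>sub\<close>, each relator is \<open>\<theta> u\<close> for some
    \<open>u\<close> that dies in every nilpotent image of the required class.\<close>
  have "pre \<theta>' ` Hom (\<phi> ` S) \<subseteq> Hom S"
  proof clarify
    fix f
    assume f: "f \<in> Hom (\<phi> ` S)"
    then have rf: "range f \<subseteq> carrier G" by (simp add: Hom_def)
    have "free_lift G (pre \<theta>' f) s = \<one>" if "s \<in> S" for s
    proof -
      have "s \<in> normal_closure free_group S"
        by (rule F.normal_closure_incl[OF S that])
      then obtain u where "s = \<theta> u" "u \<in> carrier free_group" "N #>\<^bsub>free_group\<^esub> u \<in> lower_central (free_group Mod N) k"
        using sub by auto
      then show ?thesis using kills[OF f] pre[OF rf \<theta>'.homh] \<theta>'\<theta> by simp
    qed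
    then show "pre \<theta>' f \<in> Hom S" using pre_range[OF rf] by (simp add: Hom_def)
  qed
  then have "pre \<theta>' ` Hom (\<phi> ` S) = Hom S"
    by (rule card_seteq[OF finHom _ card])
  moreover have "g \<in> Hom S" using g by (simp add: Hom_def)
  ultimately obtain f where f: "f \<in> Hom (\<phi> ` S)" "g = pre \<theta>' f"
    by blast
  then have rf: "range f \<subseteq> carrier G" by (simp add: Hom_def)
  \<comment> \<open>Since \<open>g\<close> is \<open>f\<close> after \<open>\<theta>'\<close>, its
    value at \<open>\<theta> w\<close> is that of \<open>f\<close> at \<open>w\<close>, which is
    trivial by \<open>kills\<close>.\<close>
  show ?thesis
    using kills[OF f(1) w] pre[OF rf \<theta>'.homh] \<theta>'\<theta> w f(2) by simp
qed

section \<open>Unitriangular matrices modulo p\<close>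

text \<open>Matrices are indexed by all pairs of naturals; those in the carrier agree with the identity
  matrix outside the block of indices up to \<open>n\<close>, so the convolution over intervals is the matrix
  product.\<close>

definition tri_mult :: "(nat \<Rightarrow> nat \<Rightarrow> int) \<Rightarrow> (nat \<Rightarrow> nat \<Rightarrow> int) \<Rightarrow> nat \<Rightarrow> nat \<Rightarrow> int" where
  "tri_mult M N i j = (\<Sum>k\<in>{i..j}. M i k * N k j)"

text \<open>Selects one representative per residue class. The carrier below is its set of fixed
  points, so equality in the group is equality of functions.\<close>

definition tri_reduce :: "nat \<Rightarrow> nat \<Rightarrow> (nat \<Rightarrow> nat \<Rightarrow> int) \<Rightarrow> nat \<Rightarrow> nat \<Rightarrow> int" where
  "tri_reduce p n M i j = (if i = j then 1 else if i < j \<and> j \<le> n then M i j mod int p else 0)"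

definition tri_one :: "nat \<Rightarrow> nat \<Rightarrow> int" where
  "tri_one i j = (if i = j then 1 else 0)"

definition tri_monoid :: "nat \<Rightarrow> nat \<Rightarrow> (nat \<Rightarrow> nat \<Rightarrow> int) monoid" where
  "tri_monoid p n = \<lparr>carrier = {M. tri_reduce p n M = M},
     monoid.mult = (\<lambda>M N. tri_reduce p n (tri_mult M N)), one = tri_one\<rparr>"

text \<open>Passing to units gives a group without computing inverse matrices; the elements used
  later come with explicit inverses.\<close>

abbreviation tri_group :: "nat \<Rightarrow> nat \<Rightarrow> (nat \<Rightarrow> nat \<Rightarrow> int) monoid" where
  "tri_group p n \<equiv> units_of (tri_monoid p n)"

text \<open>Both sides sum over all \<open>i \<le> l \<le> k \<le> j\<close>, in opposite
  orders.\<close>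

lemma tri_mult_assoc: "tri_mult (tri_mult A B) C = tri_mult A (tri_mult B C)"
proof (intro ext)
  fix i j
  have "tri_mult (tri_mult A B) C i j = (\<Sum>k\<in>{i..j}. \<Sum>l\<in>{l\<in>{i..j}. l \<le> k}. A i l * B l k * C k j)"
    unfolding tri_mult_def by (intro sum.cong) (auto simp: sum_distrib_right intro!: sum.cong)
  also have "\<dots> = (\<Sum>l\<in>{i..j}. \<Sum>k\<in>{k\<in>{i..j}. l \<le> k}. A i l * B l k * C k j)"
    by (rule sum.swap_restrict) auto
  also have "\<dots> = tri_mult A (tri_mult B C) i j"
    unfolding tri_mult_def by (intro sum.cong) (auto simp: sum_distrib_left mult.assoc intro!: sum.cong)
  finally show "tri_mult (tri_mult A B) C i j = tri_mult A (tri_mult B C) i j" .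
qed

lemma sum_mod_cong:
  fixes f g :: "'c \<Rightarrow> int"
  assumes "\<And>k. k \<in> A \<Longrightarrow> f k mod m = g k mod m"
  shows "sum f A mod m = sum g A mod m"
proof -
  have "(\<Sum>k\<in>A. f k mod m) mod m = (\<Sum>k\<in>A. g k mod m) mod m"
    using assms by simp
  then show ?thesis by (simp add: mod_sum_eq)
qed

lemma tri_mult_diag: "tri_mult M N i i = M i i * N i i"
  by (simp add: tri_mult_def)

lemma tri_reduce_diag [simp]: "tri_reduce p n M i i = 1"
  by (simp add: tri_reduce_def)

lemma tri_reduce_tri_reduce [simp]: "tri_reduce p n (tri_reduce p n M) = tri_reduce p n M"
  by (auto simp: tri_reduce_def fun_eq_iff)

text \<open>Entries off the diagonal are replaced by congruent ones. The hypothesis covers the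
  diagonal, which \<open>tri_reduce\<close> overwrites by 1.\<close>

lemma tri_reduce_mult_left:
  assumes "\<And>i. M i i = 1"
  shows "tri_reduce p n (tri_mult (tri_reduce p n M) N) = tri_reduce p n (tri_mult M N)"
proof -
  have "tri_mult (tri_reduce p n M) N i j mod int p = tri_mult M N i j mod int p" if "j \<le> n" for i j
    unfolding tri_mult_def
  proof (rule sum_mod_cong)
    fix k assume k: "k \<in> {i..j}"
    have "tri_reduce p n M i k mod int p = M i k mod int p"
      using k that assms by (auto simp: tri_reduce_def)
    then show "tri_reduce p n M i k * N k j mod int p = M i k * N k j mod int p"
      by (metis mod_mult_left_eq)
  qed
  then show ?thesis by (auto simp: tri_reduce_def[of _ _ "tri_mult _ _"] fun_eq_iff)
qed

lemma tri_reduce_mult_right: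
  assumes "\<And>i. N i i = 1"
  shows "tri_reduce p n (tri_mult M (tri_reduce p n N)) = tri_reduce p n (tri_mult M N)"
proof -
  have "tri_mult M (tri_reduce p n N) i j mod int p = tri_mult M N i j mod int p" if "j \<le> n" for i j
    unfolding tri_mult_def
  proof (rule sum_mod_cong)
    fix k assume k: "k \<in> {i..j}"
    have "tri_reduce p n N k j mod int p = N k j mod int p"
      using k that assms by (auto simp: tri_reduce_def)
    then show "M i k * tri_reduce p n N k j mod int p = M i k * N k j mod int p"
      by (metis mod_mult_right_eq)
  qed
  then show ?thesis by (auto simp: tri_reduce_def[of _ _ "tri_mult _ _"] fun_eq_iff)
qed

lemma carrier_tri_monoid: "carrier (tri_monoid p n) = {M. tri_reduce p n M = M}"
  and mult_tri_monoid: "M \<otimes>\<^bsub>tri_monoid p n\<^esub> N = tri_reduce p n (tri_mult M N)"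
  and one_tri_monoid: "\<one>\<^bsub>tri_monoid p n\<^esub> = tri_one"
  by (simp_all add: tri_monoid_def)

lemma tri_carrier_diag: "M \<in> carrier (tri_monoid p n) \<Longrightarrow> M i i = 1"
  using tri_reduce_diag[of p n M i] by (simp only: carrier_tri_monoid mem_Collect_eq)

lemma tri_mult_one_left: "i \<le> j \<Longrightarrow> tri_mult tri_one M i j = M i j"
proof -
  assume "i \<le> j"
  have "tri_mult tri_one M i j = (\<Sum>k\<in>{i..j}. if k = i then M k j else 0)"
    unfolding tri_mult_def by (intro sum.cong) (auto simp: tri_one_def)
  then show ?thesis using \<open>i \<le> j\<close> by simp
qed

lemma tri_mult_one_right: "i \<le> j \<Longrightarrow> tri_mult M tri_one i j = M i j"
proof -
  assume "i \<le> j"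
  have "tri_mult M tri_one i j = (\<Sum>k\<in>{i..j}. if k = j then M i k else 0)"
    unfolding tri_mult_def by (intro sum.cong) (auto simp: tri_one_def)
  then show ?thesis using \<open>i \<le> j\<close> by simp
qed

lemma monoid_tri_monoid: "monoid (tri_monoid p n)"
proof (rule monoidI)
  fix A B C
  assume "A \<in> carrier (tri_monoid p n)" "B \<in> carrier (tri_monoid p n)" "C \<in> carrier (tri_monoid p n)"
  then have "A i i = 1" "B i i = 1" "C i i = 1" for i
    by (simp_all add: tri_carrier_diag)
  then show "A \<otimes>\<^bsub>tri_monoid p n\<^esub> B \<otimes>\<^bsub>tri_monoid p n\<^esub> C = A \<otimes>\<^bsub>tri_monoid p n\<^esub> (B \<otimes>\<^bsub>tri_monoid p n\<^esub> C)"
    by (simp add: mult_tri_monoid tri_reduce_mult_left tri_reduce_mult_right tri_mult_diag tri_mult_assoc)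
next
  fix A assume A: "A \<in> carrier (tri_monoid p n)"
  have "tri_reduce p n (tri_mult tri_one A) = tri_reduce p n A"
       "tri_reduce p n (tri_mult A tri_one) = tri_reduce p n A"
    by (auto simp: tri_reduce_def fun_eq_iff tri_mult_one_left tri_mult_one_right)
  with A show "\<one>\<^bsub>tri_monoid p n\<^esub> \<otimes>\<^bsub>tri_monoid p n\<^esub> A = A" "A \<otimes>\<^bsub>tri_monoid p n\<^esub> \<one>\<^bsub>tri_monoid p n\<^esub> = A"
    by (simp_all add: mult_tri_monoid one_tri_monoid carrier_tri_monoid)
qed (auto simp: carrier_tri_monoid mult_tri_monoid one_tri_monoid tri_reduce_def tri_one_def fun_eq_iff)

lemma group_tri_group: "group (tri_group p n)"
  using monoid.units_group monoid_tri_monoid by blast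

lemma mult_tri_group: "M \<otimes>\<^bsub>tri_group p n\<^esub> N = tri_reduce p n (tri_mult M N)"
  and one_tri_group: "\<one>\<^bsub>tri_group p n\<^esub> = tri_one"
  by (simp_all add: units_of_mult units_of_one mult_tri_monoid one_tri_monoid)

lemma tri_group_reduce: "M \<in> carrier (tri_group p n) \<Longrightarrow> tri_reduce p n M = M"
  using monoid.Units_closed[OF monoid_tri_monoid] by (fastforce simp: units_of_carrier carrier_tri_monoid)

lemma tri_group_diag: "M \<in> carrier (tri_group p n) \<Longrightarrow> M i i = 1"
  using tri_reduce_diag[of p n M i] by (simp only: tri_group_reduce)

lemma finite_tri_group:
  assumes "0 < p"
  shows "finite (carrier (tri_group p n))"
proof -
  let ?S = "{f :: nat \<times> nat \<Rightarrow> int. \<forall>x. (x \<in> {..n} \<times> {..n} \<longrightarrow> f x \<in> {0..<int p}) \<and> (x \<notin> {..n} \<times> {..n} \<longrightarrow> f x = 0)}"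
  have "carrier (tri_group p n) \<subseteq> (\<lambda>f. tri_reduce p n (\<lambda>i j. f (i, j))) ` ?S"
  proof
    fix M assume "M \<in> carrier (tri_group p n)"
    then have "tri_reduce p n M = M" by (rule tri_group_reduce)
    moreover have "tri_reduce p n (\<lambda>i j. if i \<le> n \<and> j \<le> n then M i j mod int p else 0) = tri_reduce p n M"
      by (auto simp: tri_reduce_def fun_eq_iff)
    ultimately show "M \<in> (\<lambda>f. tri_reduce p n (\<lambda>i j. f (i, j))) ` ?S"
      using assms by (intro image_eqI[of _ _ "\<lambda>(i, j). if i \<le> n \<and> j \<le> n then M i j mod int p else 0"]) auto
  qed
  moreover have "finite ?S"
    by (rule finite_set_of_finite_funs) auto
  ultimately show ?thesis using finite_surj by blast
qed

text \<open>Agreement below and on the first \<open>m\<close> diagonals, the main one included.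
  Agreement with \<open>tri_one\<close> describes the filtration by superdiagonals.\<close>

definition tri_agree :: "nat \<Rightarrow> (nat \<Rightarrow> nat \<Rightarrow> int) \<Rightarrow> (nat \<Rightarrow> nat \<Rightarrow> int) \<Rightarrow> bool" where
  "tri_agree m M N \<longleftrightarrow> (\<forall>i j. j < i + m \<longrightarrow> M i j = N i j)"

lemma tri_agree_mult_left:
  assumes "tri_agree m M N"
  shows "tri_agree m (tri_reduce p n (tri_mult L M)) (tri_reduce p n (tri_mult L N))"
proof -
  have "tri_mult L M i j = tri_mult L N i j" if "j < i + m" for i j
    unfolding tri_mult_def using that assms by (intro sum.cong) (auto simp: tri_agree_def)
  then show ?thesis by (simp add: tri_agree_def tri_reduce_def)
qed

lemma tri_agree_sym: "tri_agree m M N \<Longrightarrow> tri_agree m N M"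
  and tri_agree_trans: "tri_agree m M N \<Longrightarrow> tri_agree m N L \<Longrightarrow> tri_agree m M L"
  by (simp_all add: tri_agree_def)

text \<open>For \<open>i < j < i + Suc m\<close> the vanishing entries of \<open>y\<close> leave
  only the end terms of the convolution, so both products have entry
  \<open>x i j + y i j\<close>.\<close>

lemma tri_agree_commute:
  assumes x: "x \<in> carrier (tri_group p n)" and y: "y \<in> carrier (tri_group p n)"
    and "tri_agree m y tri_one"
  shows "tri_agree (Suc m) (x \<otimes>\<^bsub>tri_group p n\<^esub> y) (y \<otimes>\<^bsub>tri_group p n\<^esub> x)"
proof -
  have y0: "y i j = 0" if "i < j" "j < i + m" for i j
    using assms(3) that by (simp add: tri_agree_def tri_one_def)
  have "tri_mult x y i j = y i j + x i j" "tri_mult y x i j = y i j + x i j" if "i < j" "j < i + Suc m" for i j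
  proof -
    have "tri_mult x y i j = (\<Sum>k\<in>{i..j}. (if k = i then y k j else 0) + (if k = j then x i k else 0))"
      unfolding tri_mult_def using that by (intro sum.cong) (auto simp: tri_group_diag[OF x] tri_group_diag[OF y] y0)
    then show "tri_mult x y i j = y i j + x i j" using that by (simp add: sum.distrib)
    have "tri_mult y x i j = (\<Sum>k\<in>{i..j}. (if k = j then y i k else 0) + (if k = i then x k j else 0))"
      unfolding tri_mult_def using that by (intro sum.cong) (auto simp: tri_group_diag[OF x] tri_group_diag[OF y] y0)
    then show "tri_mult y x i j = y i j + x i j" using that by (simp add: sum.distrib)
  qed
  then show ?thesis by (auto simp: mult_tri_group tri_agree_def tri_reduce_def)
qed

text \<open>Each commutator step gains one superdiagonal, so \<open>\<gamma>\<^sub>k\<close> lies in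
  \<open>U k\<close>; a matrix with \<open>n + 1\<close> trivial diagonals is the identity.\<close>

lemma lower_central_tri_group: "lower_central (tri_group p n) (Suc n) = {\<one>\<^bsub>tri_group p n\<^esub>}"
proof -
  interpret Q: group "tri_group p n" by (rule group_tri_group)
  define U where "U m = {M \<in> carrier (tri_group p n). tri_agree m M tri_one}" for m
  have U_inv: "tri_agree m (inv\<^bsub>tri_group p n\<^esub> x \<otimes>\<^bsub>tri_group p n\<^esub> y) tri_one"
    if "tri_agree m y x" "x \<in> carrier (tri_group p n)" for m x y
    using tri_agree_mult_left[OF that(1), of p n "inv\<^bsub>tri_group p n\<^esub> x"] Q.l_inv[OF that(2)]
    by (simp add: mult_tri_group one_tri_group)
  have U_sub: "subgroup (U m) (tri_group p n)" for m
  proof (rule Q.subgroupI)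
    show "U m \<noteq> {}"
      using Q.one_closed by (auto simp: U_def one_tri_group tri_agree_def)
    show "inv\<^bsub>tri_group p n\<^esub> x \<in> U m" if "x \<in> U m" for x
      using that U_inv[of m tri_one x] Q.r_one[of "inv\<^bsub>tri_group p n\<^esub> x"]
      by (auto simp: U_def one_tri_group tri_agree_sym)
    show "x \<otimes>\<^bsub>tri_group p n\<^esub> y \<in> U m" if "x \<in> U m" "y \<in> U m" for x y
      using that tri_agree_mult_left[of m y tri_one p n x] Q.r_one[of x] tri_agree_trans
      unfolding U_def mult_tri_group one_tri_group
      by (smt (verit) Q.m_closed mem_Collect_eq mult_tri_group)
  qed (auto simp: U_def)
  have "lower_central (tri_group p n) (Suc k) \<subseteq> U (Suc k)" for k
  proof (induction k)
    case 0
    have "M i j = tri_one i j" if M: "M \<in> carrier (tri_group p n)" and "j \<le> i" for M i j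
    proof -
      have "tri_reduce p n M i j = tri_one i j"
        using that by (simp add: tri_reduce_def tri_one_def)
      then show ?thesis by (simp only: tri_group_reduce[OF M])
    qed
    then show ?case by (auto simp: U_def tri_agree_def)
  next
    case (Suc k)
    show ?case
      unfolding lower_central.simps
    proof (intro Q.generate_subgroup_incl U_sub subsetI, clarify)
      fix x y
      assume x: "x \<in> carrier (tri_group p n)" and "y \<in> lower_central (tri_group p n) (Suc k)"
      then have y: "y \<in> carrier (tri_group p n)" "tri_agree (Suc k) y tri_one"
        using Suc by (auto simp: U_def)
      have "comm (tri_group p n) x y = inv\<^bsub>tri_group p n\<^esub> (y \<otimes>\<^bsub>tri_group p n\<^esub> x) \<otimes>\<^bsub>tri_group p n\<^esub> (x \<otimes>\<^bsub>tri_group p n\<^esub> y)"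
        using x y by (simp add: comm_def Q.inv_mult_group Q.m_assoc)
      then show "comm (tri_group p n) x y \<in> U (Suc (Suc k))"
        using U_inv[OF tri_agree_commute[OF x y]] x y by (simp add: U_def)
    qed
  qed
  moreover have "U (Suc n) \<subseteq> {\<one>\<^bsub>tri_group p n\<^esub>}"
  proof
    fix M assume M: "M \<in> U (Suc n)"
    then have red: "tri_reduce p n M = M" by (simp add: U_def tri_group_reduce)
    have "M i j = tri_one i j" for i j
    proof (cases "j < i + Suc n")
      case True
      then show ?thesis using M by (simp add: U_def tri_agree_def)
    next
      \<comment> \<open>Here \<open>j > n\<close>, so the entry lies outside the block and is zero
        by normalisation.\<close>
      case False
      then have "tri_reduce p n M i j = tri_one i j" by (simp add: tri_reduce_def tri_one_def)
      then show ?thesis by (simp add: red)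
    qed
    then show "M \<in> {\<one>\<^bsub>tri_group p n\<^esub>}" by (auto simp: one_tri_group)
  qed
  ultimately show ?thesis
    using subgroup.one_closed[OF Q.subgroup_lower_central] by blast
qed

section \<open>Residual nilpotence of free products of cyclic groups of order p\<close>

text \<open>A word \<open>cs\<close> without repeated neighbours defines a path with labelled edges; \<open>c\<close> acts by
  \<open>1 + X\<^sub>c\<close>, where \<open>X\<^sub>c\<close> moves along the edges labelled \<open>c\<close> and thus squares to zero.\<close>

definition path_matrix :: "nat \<Rightarrow> 'c list \<Rightarrow> 'c \<Rightarrow> int \<Rightarrow> nat \<Rightarrow> nat \<Rightarrow> int" where
  "path_matrix p cs c t i j = (if i = j then 1 else
     if j = Suc i \<and> j \<le> length cs \<and> cs ! i = c then t mod int p else 0)"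

text \<open>Row \<open>i\<close> of a path matrix is supported on the columns \<open>i\<close> and
  \<open>Suc i\<close>.\<close>

lemma tri_mult_path_matrix:
  assumes "i < j"
  shows "tri_mult (path_matrix p cs c t) M i j = M i j + path_matrix p cs c t i (Suc i) * M (Suc i) j"
proof -
  have "tri_mult (path_matrix p cs c t) M i j =
      (\<Sum>k\<in>{i..j}. (if k = i then M k j else 0) + (if k = Suc i then path_matrix p cs c t i k * M k j else 0))"
    unfolding tri_mult_def by (intro sum.cong) (auto simp: path_matrix_def)
  then show ?thesis using assms by (simp add: sum.distrib)
qed

lemma path_matrix_add:
  assumes "\<And>i. Suc i < length cs \<Longrightarrow> cs ! i \<noteq> cs ! Suc i"
  shows "tri_reduce p (length cs) (tri_mult (path_matrix p cs c s) (path_matrix p cs c t)) = path_matrix p cs c (s + t)"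
proof (intro ext)
  fix i j
  consider "j < i" | "j = i" | "j = Suc i" | "Suc i < j" by linarith
  then show "tri_reduce p (length cs) (tri_mult (path_matrix p cs c s) (path_matrix p cs c t)) i j = path_matrix p cs c (s + t) i j"
  proof cases
    case 3
    then show ?thesis
      by (simp add: tri_reduce_def tri_mult_path_matrix) (simp add: path_matrix_def mod_simps add.commute)
  next
    \<comment> \<open>A nonzero contribution would come from two consecutive edges with label
      \<open>c\<close>, which the hypothesis on neighbours excludes.\<close>
    case 4
    then show ?thesis
      using assms[of i] by (auto simp: tri_reduce_def tri_mult_path_matrix) (auto simp: path_matrix_def)
  qed (auto simp: tri_reduce_def path_matrix_def)
qed

lemma path_matrix_zero: "path_matrix p cs c 0 = tri_one"
  by (auto simp: path_matrix_def tri_one_def fun_eq_iff)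

lemma path_matrix_closed:
  assumes "\<And>i. Suc i < length cs \<Longrightarrow> cs ! i \<noteq> cs ! Suc i"
  shows "path_matrix p cs c t \<in> carrier (tri_group p (length cs))"
proof -
  have "path_matrix p cs c s \<in> carrier (tri_monoid p (length cs))" for s
    by (auto simp: carrier_tri_monoid tri_reduce_def path_matrix_def fun_eq_iff)
  moreover have "path_matrix p cs c t \<otimes>\<^bsub>tri_monoid p (length cs)\<^esub> path_matrix p cs c (- t) = \<one>\<^bsub>tri_monoid p (length cs)\<^esub>"
    "path_matrix p cs c (- t) \<otimes>\<^bsub>tri_monoid p (length cs)\<^esub> path_matrix p cs c t = \<one>\<^bsub>tri_monoid p (length cs)\<^esub>"
    by (simp_all add: mult_tri_monoid one_tri_monoid path_matrix_add[OF assms] path_matrix_zero)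
  ultimately show ?thesis by (auto simp: units_of_carrier Units_def)
qed

text \<open>Used to identify the powers of a path matrix: \<open>path_matrix_add\<close> makes it a
  one-parameter family in \<open>t\<close>.\<close>

lemma (in group) additive_eq_int_pow:
  assumes "\<And>t. e t \<in> carrier G" "\<And>s t. e (s + t) = e s \<otimes> e t"
  shows "e t = e 1 [^] (t :: int)"
proof -
  have e0: "e 0 = \<one>" using assms(2)[of 0 0] assms(1) by (simp add: r_cancel_one')
  have nat: "e (int n) = e 1 [^] n" for n
    by (induction n) (use assms(2)[of "int _" 1] in \<open>simp_all add: e0 add.commute\<close>)
  show ?thesis
  proof (cases t)
    case (nonneg n)
    then show ?thesis by (simp add: nat int_pow_int)
  next
    case (neg n)
    have "e t \<otimes> e (int (Suc n)) = \<one>"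
      unfolding neg assms(2)[symmetric] by (simp add: e0)
    then have "e t = inv (e (int (Suc n)))"
      using assms(1) by (metis inv_equality)
    then show ?thesis
      unfolding neg nat by (metis assms(1) int_pow_neg_int)
  qed
qed

section \<open>Products of syllables with integer exponents\<close>

definition syllable_prod :: "('a, 'b) monoid_scheme \<Rightarrow> ('c \<Rightarrow> 'a) \<Rightarrow> ('c \<times> int) list \<Rightarrow> 'a" where
  "syllable_prod G f l = foldr (\<lambda>(c, t) y. f c [^]\<^bsub>G\<^esub> t \<otimes>\<^bsub>G\<^esub> y) l \<one>\<^bsub>G\<^esub>"

lemma syllable_prod_Nil [simp]: "syllable_prod G f [] = \<one>\<^bsub>G\<^esub>"
  and syllable_prod_Cons [simp]: "syllable_prod G f (x # l) = f (fst x) [^]\<^bsub>G\<^esub> snd x \<otimes>\<^bsub>G\<^esub> syllable_prod G f l"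
  by (simp_all add: syllable_prod_def case_prod_beta)

context group
begin

lemma syllable_prod_closed: "range f \<subseteq> carrier G \<Longrightarrow> syllable_prod G f l \<in> carrier G"
  by (induction l) auto

lemma syllable_prod_append:
  assumes "range f \<subseteq> carrier G"
  shows "syllable_prod G f (l @ l') = syllable_prod G f l \<otimes> syllable_prod G f l'"
proof -
  have "f c \<in> carrier G" for c using assms by auto
  then show ?thesis by (induction l) (simp_all add: m_assoc syllable_prod_closed assms)
qed

end

lemma (in group_hom) hom_syllable_prod:
  assumes "range f \<subseteq> carrier G"
  shows "h (syllable_prod G f l) = syllable_prod H (\<lambda>c. h (f c)) l"
proof -
  have "f c \<in> carrier G" for c using assms by auto
  then show ?thesis
    by (induction l) (simp_all add: G.syllable_prod_closed assms hom_int_pow)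
qed

lemma free_group_syllables:
  assumes "w \<in> carrier free_group"
  shows "\<exists>l. w = syllable_prod free_group free_gen l"
  using assms
proof (induction w rule: free_group_induct)
  case one
  then show ?case using syllable_prod_Nil by metis
next
  case (gen c w)
  then obtain l where "w = syllable_prod free_group free_gen l" by blast
  then have "free_gen c \<otimes>\<^bsub>free_group\<^esub> w = syllable_prod free_group free_gen ((c, 1) # l)"
    by simp
  then show ?case by blast
next
  case (inv c w)
  then obtain l where "w = syllable_prod free_group free_gen l" by blast
  then have "inv\<^bsub>free_group\<^esub> free_gen c \<otimes>\<^bsub>free_group\<^esub> w = syllable_prod free_group free_gen ((c, -1) # l)"
    using F.int_pow_neg[of "free_gen c" 1] by simp
  then show ?case by blast
qed

text \<open>A syllable whose exponent is divisible by \<open>p\<close> could be dropped, and two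
  neighbours with the same generator could be merged; either shortens the expression.\<close>

lemma (in group) shortest_syllables:
  assumes f: "range f \<subseteq> carrier G" and fp: "\<And>c. f c [^] p = \<one>"
    and min: "\<And>l'. syllable_prod G f l' = syllable_prod G f l \<Longrightarrow> length l \<le> length l'"
  shows "i < length l \<Longrightarrow> \<not> int p dvd snd (l ! i)"
    and "Suc i < length l \<Longrightarrow> fst (l ! i) \<noteq> fst (l ! Suc i)"
proof -
  have fc: "f c \<in> carrier G" for c using f by auto
  show "\<not> int p dvd snd (l ! i)" if i: "i < length l"
  proof
    assume dvd: "int p dvd snd (l ! i)"
    obtain xs x ys where l: "l = xs @ x # ys" "x = l ! i"
      using id_take_nth_drop[OF i] by blast
    then obtain q where q: "snd x = int p * q" using dvd unfolding dvd_def by metis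
    have "f (fst x) [^] snd x = \<one>"
      unfolding q using fc fp by (simp add: int_pow_pow[symmetric] int_pow_int)
    then have "syllable_prod G f (xs @ ys) = syllable_prod G f l"
      unfolding l(1) by (simp add: syllable_prod_append f syllable_prod_closed)
    from min[OF this] show False by (simp add: l(1))
  qed
  show "fst (l ! i) \<noteq> fst (l ! Suc i)" if i: "Suc i < length l"
  proof
    assume eq: "fst (l ! i) = fst (l ! Suc i)"
    have l: "l = take i l @ l ! i # l ! Suc i # drop (Suc (Suc i)) l"
      using i by (simp add: Cons_nth_drop_Suc)
    have "syllable_prod G f (take i l @ (fst (l ! i), snd (l ! i) + snd (l ! Suc i)) # drop (Suc (Suc i)) l)
        = syllable_prod G f l"
      using arg_cong[OF l, of "syllable_prod G f"]
      by (simp add: syllable_prod_append f syllable_prod_closed fc eq int_pow_mult m_assoc)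
    from min[OF this] i show False by simp
  qed
qed

text \<open>The path has one edge per syllable, and the only way from its start to its end uses each
  edge once. The corner entry is thus, modulo \<open>p\<close>, the product of all exponents, which
  is nonzero for prime \<open>p\<close>.\<close>

lemma path_syllable_prod_nontrivial:
  assumes p: "Factorial_Ring.prime p" and l: "l \<noteq> []"
    and exps: "\<And>i. i < length l \<Longrightarrow> \<not> int p dvd snd (l ! i)"
    and alt: "\<And>i. Suc i < length l \<Longrightarrow> fst (l ! i) \<noteq> fst (l ! Suc i)"
  defines "cs \<equiv> map fst l"
  shows "syllable_prod (tri_group p (length cs)) (\<lambda>c. path_matrix p cs c 1) l \<noteq> \<one>\<^bsub>tri_group p (length cs)\<^esub>"
proof -
  let ?n = "length cs"
  let ?f = "\<lambda>c. path_matrix p cs c 1"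
  have n: "?n = length l" by (simp add: cs_def)
  interpret Q: group "tri_group p ?n" by (rule group_tri_group)
  have alt': "\<And>i. Suc i < length cs \<Longrightarrow> cs ! i \<noteq> cs ! Suc i"
    using alt by (simp add: cs_def)
  note cl = path_matrix_closed[OF alt']
  have pow: "?f c [^]\<^bsub>tri_group p ?n\<^esub> t = path_matrix p cs c t" for c and t :: int
    using Q.additive_eq_int_pow[of "path_matrix p cs c" t] cl by (simp add: mult_tri_group path_matrix_add[OF alt'])
  define P where "P m = syllable_prod (tri_group p ?n) ?f (drop m l)" for m
  have step: "P m i ?n = (P (Suc m) i ?n + path_matrix p cs (fst (l ! m)) (snd (l ! m)) i (Suc i) * P (Suc m) (Suc i) ?n) mod int p"
    if "m < ?n" "i < ?n" for m i
  proof -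
    have "P m = tri_reduce p ?n (tri_mult (path_matrix p cs (fst (l ! m)) (snd (l ! m))) (P (Suc m)))"
      using that by (simp add: P_def Cons_nth_drop_Suc[symmetric] pow[unfolded n] mult_tri_group n)
    then show ?thesis
      using that by (simp add: tri_reduce_def tri_mult_path_matrix)
  qed
  \<comment> \<open>In the last column, the product of the syllables from position \<open>m\<close>
    on vanishes above row \<open>m\<close> and is nonzero modulo \<open>p\<close> in row
    \<open>m\<close>. Descending induction starts from the empty product, the identity.\<close>
  have "(\<forall>i<m. P m i ?n = 0) \<and> \<not> int p dvd P m m ?n" if "m \<le> ?n" for m
    using that
  proof (induction rule: inc_induct)
    case base
    then show ?case
      using p by (auto simp: P_def n one_tri_group tri_one_def)
  next
    case (step m)
    have *: "P (Suc m) i ?n = 0" if "i \<le> m" for i using step that by simp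
    have "path_matrix p cs (fst (l ! m)) (snd (l ! m)) m (Suc m) = snd (l ! m) mod int p"
      using step n by (simp add: path_matrix_def cs_def)
    then have "P m m ?n = (snd (l ! m) mod int p * P (Suc m) (Suc m) ?n) mod int p"
      using \<open>\<And>m i. m < ?n \<Longrightarrow> i < ?n \<Longrightarrow> _\<close>[of m m] step * by simp
    then have "P m m ?n = (snd (l ! m) * P (Suc m) (Suc m) ?n) mod int p"
      by (simp add: mod_mult_left_eq)
    moreover have "\<not> int p dvd snd (l ! m) * P (Suc m) (Suc m) ?n"
      using step exps[of m] n p by (simp add: prime_dvd_mult_iff)
    ultimately have "\<not> int p dvd P m m ?n"
      by (simp add: dvd_mod_iff)
    moreover have "P m i ?n = 0" if "i < m" for i
      using \<open>\<And>m i. m < ?n \<Longrightarrow> i < ?n \<Longrightarrow> _\<close>[of m i] step(1,2) that *[of i] *[of "Suc i"] by simp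
    ultimately show ?case by blast
  qed
  from this[of 0] have "\<not> int p dvd P 0 0 ?n" by simp
  then have "P 0 \<noteq> tri_one"
    using l n by (auto simp: tri_one_def)
  then show ?thesis by (simp add: P_def one_tri_group)
qed

text \<open>A shortest syllable expression for the coset of \<open>w\<close> is nonempty and
  alternating; its labels define the path whose matrices detect \<open>w\<close>.\<close>

lemma cyclic_free_product_residually_tri:
  assumes p: "Factorial_Ring.prime p" and w: "w \<in> carrier free_group"
    "w \<notin> normal_closure free_group (range (\<lambda>c. free_gen c [^]\<^bsub>free_group\<^esub> p))"
  obtains n g where "range g \<subseteq> carrier (tri_group p n)"
    "\<And>c. g c [^]\<^bsub>tri_group p n\<^esub> p = \<one>\<^bsub>tri_group p n\<^esub>"
    "free_lift (tri_group p n) g w \<noteq> \<one>\<^bsub>tri_group p n\<^esub>"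
proof -
  define R where "R = range (\<lambda>c::'a. free_gen c [^]\<^bsub>free_group\<^esub> p)"
  define K where "K = normal_closure free_group R"
  have R: "R \<subseteq> carrier free_group" by (auto simp: R_def)
  have K: "K \<lhd> free_group" unfolding K_def by (rule F.normal_normal_closure[OF R])
  have Kp: "free_gen c [^]\<^bsub>free_group\<^esub> p \<in> K" for c
    unfolding K_def by (rule F.normal_closure_incl[OF R]) (simp add: R_def)
  have wK: "w \<notin> K" using w(2) by (simp add: K_def R_def)
  let ?\<Gamma> = "free_group Mod K"
  interpret q: group_hom free_group ?\<Gamma> "\<lambda>w. K #>\<^bsub>free_group\<^esub> w"
    by (rule F.group_hom_Mod[OF K])
  define f where "f c = K #>\<^bsub>free_group\<^esub> free_gen c" for c
  have f: "range f \<subseteq> carrier ?\<Gamma>" by (rule image_subsetI) (simp only: f_def q.hom_closed[OF free_gen_closed])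
  have fp: "f c [^]\<^bsub>?\<Gamma>\<^esub> p = \<one>\<^bsub>?\<Gamma>\<^esub>" for c
    using q.hom_nat_pow[of "free_gen c" p] F.coset_eq_one_iff[OF K, of "free_gen c [^]\<^bsub>free_group\<^esub> p"] Kp
    by (simp add: f_def)
  obtain l\<^sub>0 where "w = syllable_prod free_group free_gen l\<^sub>0"
    using free_group_syllables[OF w(1)] by blast
  then have "syllable_prod ?\<Gamma> f l\<^sub>0 = K #>\<^bsub>free_group\<^esub> w"
    using q.hom_syllable_prod[of free_gen l\<^sub>0] by (simp add: image_subset_iff f_def[abs_def])
  then obtain l where l: "syllable_prod ?\<Gamma> f l = K #>\<^bsub>free_group\<^esub> w"
    "\<And>l'. syllable_prod ?\<Gamma> f l' = K #>\<^bsub>free_group\<^esub> w \<Longrightarrow> length l \<le> length l'"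
    using ex_has_least_nat[of "\<lambda>l. syllable_prod ?\<Gamma> f l = K #>\<^bsub>free_group\<^esub> w" l\<^sub>0 length] by blast
  have min: "\<And>l'. syllable_prod ?\<Gamma> f l' = syllable_prod ?\<Gamma> f l \<Longrightarrow> length l \<le> length l'"
    using l by simp
  note exps = q.H.shortest_syllables(1)[OF f fp min] and alt = q.H.shortest_syllables(2)[OF f fp min]
  have "K #>\<^bsub>free_group\<^esub> w \<noteq> \<one>\<^bsub>?\<Gamma>\<^esub>"
    using wK F.coset_eq_one_iff[OF K w(1)] by blast
  then have "l \<noteq> []"
    unfolding l(1)[symmetric] using syllable_prod_Nil[of ?\<Gamma> f] by metis
  define cs where "cs = map fst l"
  define g where "g c = path_matrix p cs c 1" for c
  let ?Q = "tri_group p (length cs)"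
  interpret Q: group ?Q by (rule group_tri_group)
  have alt': "\<And>i. Suc i < length cs \<Longrightarrow> cs ! i \<noteq> cs ! Suc i"
    using alt by (simp add: cs_def)
  have g: "range g \<subseteq> carrier ?Q" using path_matrix_closed[OF alt'] by (auto simp: g_def)
  have "g c [^]\<^bsub>?Q\<^esub> int p = path_matrix p cs c (int p)" for c
    using Q.additive_eq_int_pow[of "path_matrix p cs c" "int p"] path_matrix_closed[OF alt']
    by (simp add: g_def mult_tri_group path_matrix_add[OF alt'])
  moreover have "path_matrix p cs c (int p) = tri_one" for c
    by (auto simp: path_matrix_def tri_one_def fun_eq_iff)
  ultimately have gp: "g c [^]\<^bsub>?Q\<^esub> p = \<one>\<^bsub>?Q\<^esub>" for c
    by (simp add: one_tri_group int_pow_int)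
  interpret g: group_hom free_group ?Q "free_lift ?Q g"
    using Q.free_lift_hom[OF g] by (simp add: group_hom_def group_hom_axioms_def group_free_group Q.is_group)
  have "R \<subseteq> kernel free_group ?Q (free_lift ?Q g)"
    using gp by (auto simp: R_def kernel_def g.hom_nat_pow Q.free_lift_gen[OF g])
  then have ker: "K \<subseteq> kernel free_group ?Q (free_lift ?Q g)"
    unfolding K_def by (rule F.normal_closure_minimal[OF g.normal_kernel])
  \<comment> \<open>The expression \<open>l\<close> equals \<open>w\<close> only modulo
    \<open>K\<close>, so the evaluation has to pass through the quotient.\<close>
  obtain h where h: "h \<in> hom ?\<Gamma> ?Q" "\<And>u. u \<in> carrier free_group \<Longrightarrow> h (K #>\<^bsub>free_group\<^esub> u) = free_lift ?Q g u"
    using g.FactGroup_universal_kernel[OF K ker] by blast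
  interpret h: group_hom ?\<Gamma> ?Q h
    using h(1) by (simp add: group_hom_def group_hom_axioms_def)
  have "free_lift ?Q g w = h (syllable_prod ?\<Gamma> f l)"
    using h(2)[OF w(1)] l(1) by simp
  also have "\<dots> = syllable_prod ?Q g l"
    using h.hom_syllable_prod[OF f] h(2) Q.free_lift_gen[OF g] by (simp add: f_def)
  finally have "free_lift ?Q g w \<noteq> \<one>\<^bsub>?Q\<^esub>"
    using path_syllable_prod_nontrivial[OF p \<open>l \<noteq> []\<close> exps alt] by (simp add: cs_def g_def[abs_def])
  then show ?thesis by (rule that[OF g gp])
qed

section \<open>Traces in the special linear group of degree two\<close>

text \<open>The entries are listed row by row.\<close>

type_synonym 'r mat2 = "'r \<times> 'r \<times> 'r \<times> 'r"

fun mat2_mult :: "'r::comm_ring_1 mat2 \<Rightarrow> 'r mat2 \<Rightarrow> 'r mat2" where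
  "mat2_mult (a, b, c, d) (e, f, g, h) = (a * e + b * g, a * f + b * h, c * e + d * g, c * f + d * h)"

fun mat2_det :: "'r::comm_ring_1 mat2 \<Rightarrow> 'r" where
  "mat2_det (a, b, c, d) = a * d - b * c"

fun mat2_trace :: "'r::comm_ring_1 mat2 \<Rightarrow> 'r" where
  "mat2_trace (a, b, c, d) = a + d"

fun mat2_adj :: "'r::comm_ring_1 mat2 \<Rightarrow> 'r mat2" where
  "mat2_adj (a, b, c, d) = (d, - b, - c, a)"

definition SL2 :: "'r::comm_ring_1 mat2 monoid" where
  "SL2 = \<lparr>carrier = {M. mat2_det M = 1}, monoid.mult = mat2_mult, one = (1, 0, 0, 1)\<rparr>"

lemma carrier_SL2: "carrier SL2 = {M. mat2_det M = 1}"
  and mult_SL2: "M \<otimes>\<^bsub>SL2\<^esub> N = mat2_mult M N"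
  and one_SL2: "\<one>\<^bsub>SL2\<^esub> = (1, 0, 0, 1)"
  by (simp_all add: SL2_def)

lemma mat2_mult_assoc: "mat2_mult (mat2_mult A B) C = mat2_mult A (mat2_mult B C)"
  by (cases A; cases B; cases C) (simp add: algebra_simps)

lemma mat2_det_mult: "mat2_det (mat2_mult A B) = mat2_det A * mat2_det B"
  by (cases A; cases B) (simp add: algebra_simps)

lemma mat2_adj_mult:
  "mat2_mult (mat2_adj A) A = (mat2_det A, 0, 0, mat2_det A)"
  by (cases A) (simp add: algebra_simps)

lemma group_SL2: "group (SL2 :: 'r::comm_ring_1 mat2 monoid)"
proof (rule groupI)
  fix x :: "'r mat2"
  assume "x \<in> carrier SL2"
  moreover have "mat2_det (mat2_adj x) = mat2_det x"
    by (cases x) (simp add: algebra_simps)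
  ultimately show "\<exists>y\<in>carrier SL2. y \<otimes>\<^bsub>SL2\<^esub> x = \<one>\<^bsub>SL2\<^esub>"
    by (intro bexI[of _ "mat2_adj x"]) (simp_all add: carrier_SL2 mult_SL2 one_SL2 mat2_adj_mult)
next
  fix x :: "'r mat2"
  show "\<one>\<^bsub>SL2\<^esub> \<otimes>\<^bsub>SL2\<^esub> x = x" by (cases x) (simp add: mult_SL2 one_SL2)
qed (simp_all add: carrier_SL2 mult_SL2 one_SL2 mat2_mult_assoc mat2_det_mult)

interpretation SL2: group "SL2 :: 'r::comm_ring_1 mat2 monoid"
  by (rule group_SL2)

lemma inv_SL2:
  assumes "M \<in> carrier SL2"
  shows "inv\<^bsub>SL2\<^esub> M = mat2_adj M"
proof (rule SL2.inv_equality[OF _ assms])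
  have "mat2_det (mat2_adj M) = mat2_det M"
    by (cases M) (simp add: algebra_simps)
  then show "mat2_adj M \<in> carrier SL2"
    using assms by (simp add: carrier_SL2)
  show "mat2_adj M \<otimes>\<^bsub>SL2\<^esub> M = \<one>\<^bsub>SL2\<^esub>"
    using assms by (simp add: carrier_SL2 mult_SL2 one_SL2 mat2_adj_mult)
qed

text \<open>Cayley-Hamilton for \<open>A\<close>, multiplied by \<open>M\<close> and traced.\<close>

lemma mat2_trace_square:
  "mat2_trace (mat2_mult A (mat2_mult A M)) = mat2_trace A * mat2_trace (mat2_mult A M) - mat2_det A * mat2_trace M"
  by (cases A; cases M) (simp add: algebra_simps)

text \<open>The sum of \<open>A\<close> and its adjugate is the scalar
  \<open>mat2_trace A\<close>.\<close>

lemma mat2_trace_adj: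
  "mat2_trace (mat2_mult (mat2_adj A) M) = mat2_trace A * mat2_trace M - mat2_trace (mat2_mult A M)"
  by (cases A; cases M) (simp add: algebra_simps)

text \<open>The polarised Cayley-Hamilton identity, which expresses \<open>AB + BA\<close> through
  \<open>A\<close>, \<open>B\<close> and a scalar.\<close>

lemma mat2_trace_swap:
  "mat2_trace (mat2_mult B (mat2_mult A M)) =
     mat2_trace A * mat2_trace (mat2_mult B M) + mat2_trace B * mat2_trace (mat2_mult A M)
     + (mat2_trace (mat2_mult A B) - mat2_trace A * mat2_trace B) * mat2_trace M
     - mat2_trace (mat2_mult A (mat2_mult B M))"
  by (cases A; cases B; cases M) (simp add: algebra_simps)

text \<open>For determinant 1 the left side is \<open>tr (A[B,A])\<close>. By cyclicity and
  Cayley-Hamilton it equals \<open>tr A * tr [B,A] - tr A\<close>, and Fricke's formula gives the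
  commutator trace. Keeping the determinants makes this a polynomial identity.\<close>

lemma mat2_trace_relator:
  "mat2_trace (mat2_mult A (mat2_mult (mat2_adj B) (mat2_mult (mat2_adj A) (mat2_mult B A)))) =
     mat2_trace A * (mat2_det B * mat2_trace A ^ 2 + mat2_det A * mat2_trace B ^ 2 + mat2_trace (mat2_mult A B) ^ 2
       - mat2_trace A * mat2_trace B * mat2_trace (mat2_mult A B) - 3 * mat2_det A * mat2_det B)"
  by (cases A; cases B) (simp add: algebra_simps power2_eq_square)

lemma mat2_trace_pow:
  assumes "M \<in> carrier SL2"
  shows "mat2_trace (M [^]\<^bsub>SL2\<^esub> Suc (Suc n)) =
    mat2_trace M * mat2_trace (M [^]\<^bsub>SL2\<^esub> Suc n) - mat2_trace (M [^]\<^bsub>SL2\<^esub> (n::nat))"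
proof -
  have "M [^]\<^bsub>SL2\<^esub> Suc n = mat2_mult M (M [^]\<^bsub>SL2\<^esub> n)" for n
    unfolding SL2.nat_pow_Suc2[OF assms] by (rule mult_SL2)
  then show ?thesis
    using assms by (simp only: mat2_trace_square) (simp add: carrier_SL2)
qed

text \<open>If the trace had positive degree \<open>d\<close>, the Chebyshev recursion would give \<open>M ^ n\<close> a trace of
  degree \<open>n * d\<close>; and a vanishing trace forces \<open>M\<^sup>2 = - 1\<close>.\<close>

lemma torsion_trace_constant:
  fixes M :: "'a::field_char_0 poly mat2" and p :: nat
  assumes M: "M \<in> carrier SL2" and Mp: "M [^]\<^bsub>SL2\<^esub> p = \<one>\<^bsub>SL2\<^esub>" and "odd p"
  shows "degree (mat2_trace M) = 0" and "mat2_trace M \<noteq> 0"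
proof -
  define t where "t n = mat2_trace (M [^]\<^bsub>SL2\<^esub> (n::nat))" for n
  have t0: "t 0 = 2" by (simp add: t_def one_SL2)
  have t1: "t 1 = mat2_trace M"
    unfolding t_def SL2.nat_pow_eone[OF M] ..
  have rec: "t (Suc (Suc n)) = mat2_trace M * t (Suc n) - t n" for n
    unfolding t_def by (rule mat2_trace_pow[OF M])
  have tp: "t p = 2" by (simp add: t_def Mp one_SL2)
  show "degree (mat2_trace M) = 0"
  proof (rule ccontr)
    assume pos: "degree (mat2_trace M) \<noteq> 0"
    \<comment> \<open>Two consecutive degrees are carried along because the recursion has order
      two.\<close>
    have "degree (t n) = n * degree (mat2_trace M) \<and> degree (t (Suc n)) = Suc n * degree (mat2_trace M)" for n
    proof (induction n)
      case 0
      then show ?case using t0 t1 by simp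
    next
      case (Suc n)
      then have "mat2_trace M \<noteq> 0" "t (Suc n) \<noteq> 0" using pos by auto
      then have "degree (mat2_trace M * t (Suc n)) = Suc (Suc n) * degree (mat2_trace M)"
        using Suc by (simp add: degree_mult_eq)
      moreover from this have "degree (- t n) < degree (mat2_trace M * t (Suc n))"
        using Suc pos by simp
      ultimately have "degree (t (Suc (Suc n))) = Suc (Suc n) * degree (mat2_trace M)"
        using degree_add_eq_left[of "- t n" "mat2_trace M * t (Suc n)"] by (simp add: rec)
      then show ?case using Suc by blast
    qed
    then have "degree (t p) = p * degree (mat2_trace M)" by blast
    then show False using tp pos \<open>odd p\<close> by (cases p) auto
  qed
  show "mat2_trace M \<noteq> 0"
  proof
    assume "mat2_trace M = 0"
    \<comment> \<open>With vanishing trace the recursion reads \<open>t (n + 2) = - t n\<close>, so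
      all odd traces vanish, contrary to \<open>t p = 2\<close>.\<close>
    then have "t (2 * k + 1) = 0" for k
      by (induction k) (use t1 rec in auto)
    then show False using \<open>odd p\<close> tp by (metis oddE zero_neq_numeral)
  qed
qed

section \<open>Constancy of traces\<close>

lemma degree_0_add: "degree (p :: 'a::comm_ring_1 poly) = 0 \<Longrightarrow> degree q = 0 \<Longrightarrow> degree (p + q) = 0"
  and degree_0_diff: "degree p = 0 \<Longrightarrow> degree q = 0 \<Longrightarrow> degree (p - q) = 0"
  and degree_0_mult: "degree p = 0 \<Longrightarrow> degree q = 0 \<Longrightarrow> degree (p * q) = 0"
  using degree_add_le[of p 0 q] degree_diff_le[of p 0 q] degree_mult_le[of p q] by auto

lemmas degree_0_intros = degree_0_add degree_0_diff degree_0_mult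

text \<open>Degrees add over a field, so both factors of a nonzero constant are constant. Then
  \<open>v * (v - u * t)\<close> is constant as well, whereas its degree would be twice that of a
  nonconstant \<open>v\<close>.\<close>

lemma constant_of_trace_equation:
  fixes u v t :: "'a::field_char_0 poly"
  assumes eq: "u * (u ^ 2 + t ^ 2 + v ^ 2 - u * t * v - 3) = c"
    and c: "degree c = 0" "c \<noteq> 0" and t: "degree t = 0"
  shows "degree u = 0" "degree v = 0"
proof -
  let ?e = "u ^ 2 + t ^ 2 + v ^ 2 - u * t * v - 3"
  have nz: "u \<noteq> 0" "?e \<noteq> 0" using eq c(2) by auto
  then have "degree u + degree ?e = 0"
    using eq c(1) degree_mult_eq by metis
  then have u: "degree u = 0" and e: "degree ?e = 0" by simp_all
  show "degree u = 0" by (rule u)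
  show "degree v = 0"
  proof (rule ccontr)
    assume v: "degree v \<noteq> 0"
    have "degree (u * t) = 0" by (intro degree_0_intros u t)
    then have "degree (v - u * t) = degree v"
      using degree_add_eq_left[of "- (u * t)" v] v by simp
    then have "degree (v * (v - u * t)) = degree v + degree v"
      using v by (subst degree_mult_eq) auto
    moreover have "v * (v - u * t) = ?e - u * u - t * t + 3"
      by (simp add: algebra_simps power2_eq_square)
    moreover have "degree (?e - u * u - t * t + 3) = 0"
      by (intro degree_0_intros e u t) simp
    ultimately show False using v by simp
  qed
qed

text \<open>After Fricke, the trace of a word in \<open>A\<close> and \<open>B\<close> is a
  polynomial in the traces of \<open>A\<close>, \<open>B\<close> and \<open>AB\<close>. The
  induction on words prepends one letter at a time.\<close>

lemma trace_constant_on_generated: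
  fixes h :: "(bool \<times> bool) list \<Rightarrow> 'a::comm_ring_1 poly mat2"
  assumes h: "h \<in> hom F2 SL2"
    and A: "A = h gen_a" and B: "B = h gen_b"
    and u: "degree (mat2_trace A) = 0" and t: "degree (mat2_trace B) = 0"
    and v: "degree (mat2_trace (mat2_mult A B)) = 0"
    and w: "w \<in> carrier F2"
  shows "degree (mat2_trace (h w)) = 0"
proof -
  interpret h: group_hom F2 SL2 h
    using h by (simp add: group_hom_def group_hom_axioms_def group_free_group group_SL2)
  have car: "A \<in> carrier SL2" "B \<in> carrier SL2" unfolding A B by simp_all
  then have det: "mat2_det A = 1" "mat2_det B = 1" by (simp_all add: carrier_SL2)
  \<comment> \<open>Traces of \<open>M\<close> against 1, \<open>A\<close>, \<open>B\<close> and
    \<open>AB\<close>. Left multiplication by a letter changes these four by linear combinations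
    with constant coefficients.\<close>
  define C where "C M \<longleftrightarrow> degree (mat2_trace M) = 0 \<and> degree (mat2_trace (mat2_mult A M)) = 0
    \<and> degree (mat2_trace (mat2_mult B M)) = 0 \<and> degree (mat2_trace (mat2_mult A (mat2_mult B M))) = 0" for M
  have CX: "C (mat2_mult A M)" and CY: "C (mat2_mult B M)"
    and CX': "C (mat2_mult (mat2_adj A) M)" and CY': "C (mat2_mult (mat2_adj B) M)" if "C M" for M
  proof -
    note M = that[unfolded C_def]
    have adj: "mat2_mult Z (mat2_mult (mat2_adj Z) N) = N" if "mat2_det Z = 1" for Z N :: "'a poly mat2"
    proof -
      have "mat2_mult Z (mat2_adj Z) = (1, 0, 0, 1)"
        using that by (cases Z) (simp add: algebra_simps)
      then show ?thesis
        unfolding mat2_mult_assoc[symmetric] by (cases N) simp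
    qed
    have YX: "degree (mat2_trace (mat2_mult B (mat2_mult A M))) = 0"
      unfolding mat2_trace_swap[of B A M] using M u t v by (intro degree_0_intros) auto
    \<comment> \<open>Cayley-Hamilton for \<open>AB\<close>, with the last \<open>B\<close>
      cancelled: \<open>ABA\<close> is \<open>tr (AB) * A\<close> minus \<open>det A\<close> times
      the adjugate of \<open>B\<close>.\<close>
    have "mat2_trace (mat2_mult A (mat2_mult B (mat2_mult A M))) =
        mat2_trace (mat2_mult A B) * mat2_trace (mat2_mult A M)
        - mat2_det A * (mat2_trace B * mat2_trace M - mat2_trace (mat2_mult B M))"
      by (cases A; cases B; cases M) (simp add: algebra_simps)
    then have XYX: "degree (mat2_trace (mat2_mult A (mat2_mult B (mat2_mult A M)))) = 0"
      using M u t v det by (auto intro!: degree_0_intros)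
    show CX: "C (mat2_mult A M)"
      unfolding C_def mat2_trace_square[of A M] det using M u YX XYX by (auto intro!: degree_0_intros)
    have "mat2_trace (mat2_mult A (mat2_mult B (mat2_mult B M))) =
        mat2_trace B * mat2_trace (mat2_mult A (mat2_mult B M)) - mat2_det B * mat2_trace (mat2_mult A M)"
      by (cases A; cases B; cases M) (simp add: algebra_simps)
    then show CY: "C (mat2_mult B M)"
      unfolding C_def mat2_trace_square[of B M] det using M t det by (auto intro!: degree_0_intros)
    have "mat2_trace (mat2_mult B (mat2_mult (mat2_adj A) M)) =
        mat2_trace A * mat2_trace (mat2_mult B M) - mat2_trace (mat2_mult B (mat2_mult A M))"
      "mat2_trace (mat2_mult A (mat2_mult B (mat2_mult (mat2_adj A) M))) =
        mat2_trace A * mat2_trace (mat2_mult A (mat2_mult B M)) - mat2_trace (mat2_mult A (mat2_mult B (mat2_mult A M)))"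
      by (cases A; cases B; cases M; simp add: algebra_simps)+
    then show "C (mat2_mult (mat2_adj A) M)"
      unfolding C_def adj[OF det(1)] mat2_trace_adj[of A M] using M u YX XYX by (auto intro!: degree_0_intros)
    have "mat2_trace (mat2_mult A (mat2_mult (mat2_adj B) M)) =
        mat2_trace B * mat2_trace (mat2_mult A M) - mat2_trace (mat2_mult A (mat2_mult B M))"
      by (cases A; cases B; cases M) (simp add: algebra_simps)
    then show "C (mat2_mult (mat2_adj B) M)"
      unfolding C_def adj[OF det(2)] mat2_trace_adj[of B M] using M t by (auto intro!: degree_0_intros)
  qed
  have "C (h w)"
    using w
  proof (induction w rule: free_group_induct)
    case one
    have "mat2_mult Z (1, 0, 0, 1) = Z" for Z :: "'a poly mat2" by (cases Z) simp
    then show ?case using u t v by (simp add: C_def one_SL2)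
  next
    case (gen c w)
    then show ?case using CX CY by (cases c) (simp_all add: mult_SL2 A[symmetric] B[symmetric])
  next
    case (inv c w)
    then show ?case using CX' CY' car
      by (cases c) (simp_all add: mult_SL2 inv_SL2 A[symmetric] B[symmetric])
  qed
  then show ?thesis by (simp add: C_def)
qed

lemma trace_constant_of_relators:
  fixes h :: "(bool \<times> bool) list \<Rightarrow> 'a::field_char_0 poly mat2" and p :: nat
  assumes h: "h \<in> hom F2 SL2" and p: "odd p"
    and a: "h ((gen_a \<otimes>\<^bsub>F2\<^esub> comm F2 gen_b gen_a) [^]\<^bsub>F2\<^esub> p) = \<one>\<^bsub>SL2\<^esub>"
    and b: "h (gen_b [^]\<^bsub>F2\<^esub> p) = \<one>\<^bsub>SL2\<^esub>"
    and w: "w \<in> carrier F2"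
  shows "degree (mat2_trace (h w)) = 0"
proof -
  interpret h: group_hom F2 SL2 h
    using h by (simp add: group_hom_def group_hom_axioms_def group_free_group group_SL2)
  define A where "A = h gen_a"
  define B where "B = h gen_b"
  have car: "A \<in> carrier SL2" "B \<in> carrier SL2" unfolding A_def B_def by simp_all
  then have det: "mat2_det A = 1" "mat2_det B = 1" by (simp_all add: carrier_SL2)
  define Z where "Z = A \<otimes>\<^bsub>SL2\<^esub> comm SL2 B A"
  have Z: "Z = h (gen_a \<otimes>\<^bsub>F2\<^esub> comm F2 gen_b gen_a)"
    by (simp add: Z_def A_def B_def h.hom_comm)
  have "Z \<in> carrier SL2" "Z [^]\<^bsub>SL2\<^esub> p = \<one>\<^bsub>SL2\<^esub>"
    unfolding Z using h.hom_nat_pow[of "gen_a \<otimes>\<^bsub>F2\<^esub> comm F2 gen_b gen_a" p] a by (simp_all del: h.hom_mult)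
  note c = torsion_trace_constant[OF this p]
  have "B [^]\<^bsub>SL2\<^esub> p = \<one>\<^bsub>SL2\<^esub>" using b by (simp add: B_def h.hom_nat_pow)
  note t = torsion_trace_constant[OF car(2) this p]
  have "Z = mat2_mult A (mat2_mult (mat2_adj B) (mat2_mult (mat2_adj A) (mat2_mult B A)))"
    using car by (simp add: Z_def comm_def mult_SL2 inv_SL2 mat2_mult_assoc)
  then have "mat2_trace A * (mat2_trace A ^ 2 + mat2_trace B ^ 2 + mat2_trace (mat2_mult A B) ^ 2
       - mat2_trace A * mat2_trace B * mat2_trace (mat2_mult A B) - 3) = mat2_trace Z"
    by (simp add: mat2_trace_relator det)
  note uv = constant_of_trace_equation[OF this c t(1)]
  show ?thesis
    by (rule trace_constant_on_generated[OF h A_def B_def uv(1) t(1) uv(2) w])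
qed

text \<open>\<open>diag \<zeta> \<zeta>\<^sup>-\<^sup>1\<close> and its conjugate by the matrix with rows \<open>(1 + z, z)\<close> and \<open>(1, 1)\<close>.\<close>

lemma torsion_pair_nonconstant_trace:
  fixes p :: nat
  assumes "odd p" "p \<noteq> 1"
  obtains A B :: "complex poly mat2" where "A \<in> carrier SL2" "B \<in> carrier SL2"
    "A [^]\<^bsub>SL2\<^esub> p = \<one>\<^bsub>SL2\<^esub>" "B [^]\<^bsub>SL2\<^esub> p = \<one>\<^bsub>SL2\<^esub>" "degree (mat2_trace (A \<otimes>\<^bsub>SL2\<^esub> B)) \<noteq> 0"
proof -
  define \<zeta> where "\<zeta> = cis (2 * pi / p)"
  define \<xi> where "\<xi> = inverse \<zeta>"
  have p3: "p \<ge> 3" using assms by (metis One_nat_def Suc_leI dvd_refl even_numeral le_neq_implies_less numeral_2_eq_2 numeral_3_eq_3 odd_pos)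
  have \<zeta>p: "\<zeta> ^ p = 1"
    unfolding \<zeta>_def using p3 by (simp add: DeMoivre)
  have nz: "\<zeta> * \<xi> = 1" by (simp add: \<xi>_def \<zeta>_def del: cis_inverse)
  have \<xi>p: "\<xi> ^ p = 1" using \<zeta>p by (simp add: \<xi>_def power_inverse)
  \<comment> \<open>If the two eigenvalues coincided, \<zeta> would have order dividing 2 and the
    odd number \<open>p\<close>, hence equal 1; but its imaginary part is positive.\<close>
  have ne: "\<zeta> \<noteq> \<xi>"
  proof
    assume "\<zeta> = \<xi>"
    then have "\<zeta> ^ 2 = 1" using nz by (simp add: power2_eq_square)
    then have "\<zeta> = 1" using \<zeta>p \<open>odd p\<close> by (auto elim!: oddE simp: power_mult)
    moreover have "Im \<zeta> > 0"
    proof -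
      have "2 * pi / p < pi" using p3 by (simp add: field_simps)
      then show ?thesis using p3 by (simp add: \<zeta>_def sin_gt_zero)
    qed
    ultimately show False by simp
  qed
  define D :: "complex poly mat2" where "D = ([:\<zeta>:], 0, 0, [:\<xi>:])"
  define P :: "complex poly mat2" where "P = ([:1, 1:], [:0, 1:], 1, 1)"
  have D: "D \<in> carrier SL2" using nz by (simp add: D_def carrier_SL2 one_pCons mult.commute)
  have P: "P \<in> carrier SL2" by (simp add: P_def carrier_SL2 one_pCons)
  have "D [^]\<^bsub>SL2\<^esub> n = ([:\<zeta> ^ n:], 0, 0, [:\<xi> ^ n:])" for n :: nat
    by (induction n) (simp_all add: D_def mult_SL2 one_SL2 one_pCons mult.commute)
  then have Dp: "D [^]\<^bsub>SL2\<^esub> p = \<one>\<^bsub>SL2\<^esub>" using \<zeta>p \<xi>p by (simp add: one_SL2 one_pCons)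
  define B where "B = P \<otimes>\<^bsub>SL2\<^esub> D \<otimes>\<^bsub>SL2\<^esub> inv\<^bsub>SL2\<^esub> P"
  have B: "B \<in> carrier SL2" using D P by (simp add: B_def)
  have "B [^]\<^bsub>SL2\<^esub> n = P \<otimes>\<^bsub>SL2\<^esub> D [^]\<^bsub>SL2\<^esub> n \<otimes>\<^bsub>SL2\<^esub> inv\<^bsub>SL2\<^esub> P" for n :: nat
  proof (induction n)
    case (Suc n)
    have "inv\<^bsub>SL2\<^esub> P \<otimes>\<^bsub>SL2\<^esub> (P \<otimes>\<^bsub>SL2\<^esub> Z) = Z" if "Z \<in> carrier SL2" for Z
      using that P by (simp add: SL2.m_assoc[symmetric])
    with Suc show ?case using D P by (simp add: B_def SL2.m_assoc)
  qed (use P in simp)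
  then have Yp: "B [^]\<^bsub>SL2\<^esub> p = \<one>\<^bsub>SL2\<^esub>" using Dp P by simp
  \<comment> \<open>The coefficient of the indeterminate is the square of the difference of the
    eigenvalues, nonzero by \<open>ne\<close>.\<close>
  have "mat2_trace (D \<otimes>\<^bsub>SL2\<^esub> B) = [:\<zeta> * \<zeta> + \<xi> * \<xi>, (\<zeta> - \<xi>) * (\<zeta> - \<xi>):]"
    using P by (simp add: B_def mult_SL2 inv_SL2 D_def P_def one_pCons algebra_simps)
  moreover have "(\<zeta> - \<xi>) * (\<zeta> - \<xi>) \<noteq> 0" using ne by simp
  ultimately have "degree (mat2_trace (D \<otimes>\<^bsub>SL2\<^esub> B)) \<noteq> 0" by simp
  with D B Dp Yp show ?thesis by (rule that)
qed

section \<open>The group G and the free product\<close>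

definition twist :: "(bool \<times> bool) list \<Rightarrow> (bool \<times> bool) list" where
  "twist = free_lift F2 (\<lambda>c. if c then gen_a \<otimes>\<^bsub>F2\<^esub> comm F2 gen_b gen_a else gen_b)"

lemma twist_hom: "twist \<in> hom F2 F2"
  and twist_a: "twist gen_a = gen_a \<otimes>\<^bsub>F2\<^esub> comm F2 gen_b gen_a"
  and twist_b: "twist gen_b = gen_b"
proof -
  have r: "range (\<lambda>c. if c then gen_a \<otimes>\<^bsub>F2\<^esub> comm F2 gen_b gen_a else gen_b) \<subseteq> carrier F2" by auto
  show "twist \<in> hom F2 F2" "twist gen_a = gen_a \<otimes>\<^bsub>F2\<^esub> comm F2 gen_b gen_a" "twist gen_b = gen_b"
    unfolding twist_def F.free_lift_gen[OF r] by (simp_all add: F.free_lift_hom[OF r])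
qed

lemma ia_endo_twist: "ia_endo twist"
proof -
  have "comm F2 gen_b gen_a \<in> lower_central F2 (Suc 1)"
    by (rule F.comm_in_lower_central) simp_all
  then have "gen_a \<otimes>\<^bsub>F2\<^esub> comm F2 gen_b gen_a \<otimes>\<^bsub>F2\<^esub> inv\<^bsub>F2\<^esub> gen_a \<in> lower_central F2 2"
    unfolding Suc_1 by (rule F.normal_invE(2)[OF F.normal_lower_central free_gen_closed])
  then have "lower_central F2 2 #>\<^bsub>F2\<^esub> twist gen_a = lower_central F2 2 #>\<^bsub>F2\<^esub> gen_a"
    unfolding twist_a
    using F.coset_eq_iff[OF F.normal_lower_central, of "gen_a \<otimes>\<^bsub>F2\<^esub> comm F2 gen_b gen_a" gen_a 2] by simp
  then have "lower_central F2 2 #>\<^bsub>F2\<^esub> twist (free_gen c) = lower_central F2 2 #>\<^bsub>F2\<^esub> free_gen c" for c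
    by (cases c) (simp_all add: twist_b)
  then show ?thesis by (simp add: ia_endo_def twist_hom)
qed

definition power_relators :: "nat \<Rightarrow> (bool \<times> bool) list set" where
  "power_relators p = {gen_a [^]\<^bsub>F2\<^esub> p, gen_b [^]\<^bsub>F2\<^esub> p}"

lemma power_relators_closed: "power_relators p \<subseteq> carrier F2"
  by (simp add: power_relators_def)

lemma twist_power_relators:
  "twist ` power_relators p = {(gen_a \<otimes>\<^bsub>F2\<^esub> comm F2 gen_b gen_a) [^]\<^bsub>F2\<^esub> p, gen_b [^]\<^bsub>F2\<^esub> p}"
proof -
  interpret twist: group_hom F2 F2 twist
    by (rule group_hom_free_endo[OF twist_hom])
  show ?thesis
    by (simp add: power_relators_def twist.hom_nat_pow twist_a twist_b)
qed

lemma K_CpCp_eq: "K_CpCp p = normal_closure F2 (power_relators p)"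
  by (simp add: K_CpCp_def power_relators_def)

lemma N_G_eq: "N_G p = normal_closure F2 (twist ` power_relators p)"
  by (simp add: N_G_def twist_power_relators)

lemma twist_power_relators_closed: "twist ` power_relators p \<subseteq> carrier F2"
  by (simp add: twist_power_relators)

lemma normal_K_CpCp: "K_CpCp p \<lhd> F2"
  unfolding K_CpCp_eq by (rule F.normal_normal_closure[OF power_relators_closed])

lemma normal_N_G: "N_G p \<lhd> F2"
  unfolding N_G_eq by (rule F.normal_normal_closure[OF twist_power_relators_closed])

lemma group_hom_CpCp: "group_hom F2 (CpCp p) (\<lambda>w. K_CpCp p #>\<^bsub>F2\<^esub> w)"
  unfolding CpCp_def by (rule F.group_hom_Mod[OF normal_K_CpCp])

lemma group_hom_G_grp: "group_hom F2 (G_grp p) (\<lambda>w. N_G p #>\<^bsub>F2\<^esub> w)"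
  unfolding G_grp_def by (rule F.group_hom_Mod[OF normal_N_G])

lemma group_G_grp: "group (G_grp p)"
  using group_hom_G_grp group_hom.axioms(2) by blast

lemma H_grp_eq: "H_grp p = G_grp p Mod nilpotent_residual (G_grp p)"
  by (simp add: H_grp_def nilpotent_residual_def)

lemma N_H_eq: "N_H p = {w \<in> carrier F2. N_G p #>\<^bsub>F2\<^esub> w \<in> nilpotent_residual (G_grp p)}"
  by (simp add: N_H_def nilpotent_residual_def)

lemma relators_in_N_G: "twist ` power_relators p \<subseteq> N_G p"
  unfolding N_G_eq using F.normal_closure_incl[OF twist_power_relators_closed] by blast

lemma N_G_subset_N_H: "N_G p \<subseteq> N_H p"
proof
  fix w assume w: "w \<in> N_G p"
  interpret G: group "G_grp p" by (rule group_G_grp)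
  have car: "w \<in> carrier F2"
    using w subgroup.mem_carrier[OF normal_imp_subgroup[OF normal_N_G]] by blast
  have "N_G p #>\<^bsub>F2\<^esub> w = \<one>\<^bsub>G_grp p\<^esub>"
    unfolding G_grp_def using w F.coset_eq_one_iff[OF normal_N_G car] by blast
  then show "w \<in> N_H p"
    using car subgroup.one_closed[OF normal_imp_subgroup[OF G.normal_nilpotent_residual]]
    by (simp add: N_H_eq)
qed

text \<open>Stated for maps from \<open>F2\<close> killing the relators of \<open>G\<close>, so that
  it applies to an isomorphism from \<open>H\<close> and to automorphisms of \<open>F2\<close>
  alike.\<close>

lemma no_surjection_onto_CpCp:
  assumes p: "Factorial_Ring.prime p" "odd p"
    and f: "f \<in> hom F2 (CpCp p)" "f ` carrier F2 = carrier (CpCp p)"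
    and rel: "\<And>r. r \<in> twist ` power_relators p \<Longrightarrow> f r = \<one>\<^bsub>CpCp p\<^esub>"
  shows False
proof -
  interpret q: group_hom F2 "CpCp p" "\<lambda>w. K_CpCp p #>\<^bsub>F2\<^esub> w" by (rule group_hom_CpCp)
  interpret f: group_hom F2 "CpCp p" f
    using f(1) by (simp add: group_hom_def group_hom_axioms_def group_free_group q.H.is_group)
  have "p \<noteq> 1" using p by auto
  obtain A B :: "complex poly mat2" where AB: "A \<in> carrier SL2" "B \<in> carrier SL2"
    "A [^]\<^bsub>SL2\<^esub> p = \<one>\<^bsub>SL2\<^esub>" "B [^]\<^bsub>SL2\<^esub> p = \<one>\<^bsub>SL2\<^esub>" "degree (mat2_trace (A \<otimes>\<^bsub>SL2\<^esub> B)) \<noteq> 0"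
    using torsion_pair_nonconstant_trace[OF p(2) \<open>p \<noteq> 1\<close>] .
  define g where "g c = (if c then A else B)" for c
  have g: "range g \<subseteq> carrier SL2" using AB by (auto simp: g_def)
  interpret \<rho>: group_hom F2 SL2 "free_lift SL2 g"
    using SL2.free_lift_hom[OF g] by (simp add: group_hom_def group_hom_axioms_def group_free_group group_SL2)
  have "power_relators p \<subseteq> kernel F2 SL2 (free_lift SL2 g)"
    using AB by (simp add: power_relators_def kernel_def \<rho>.hom_nat_pow SL2.free_lift_gen[OF g] g_def)
  then have "K_CpCp p \<subseteq> kernel F2 SL2 (free_lift SL2 g)"
    unfolding K_CpCp_eq by (rule F.normal_closure_minimal[OF \<rho>.normal_kernel])
  then obtain h where h: "h \<in> hom (CpCp p) SL2" "\<And>w. w \<in> carrier F2 \<Longrightarrow> h (K_CpCp p #>\<^bsub>F2\<^esub> w) = free_lift SL2 g w"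
    using \<rho>.FactGroup_universal_kernel[OF normal_K_CpCp] unfolding CpCp_def by blast
  interpret h: group_hom "CpCp p" SL2 h
    using h(1) by (simp add: group_hom_def group_hom_axioms_def group_SL2 q.H.is_group)
  have hf: "(\<lambda>w. h (f w)) \<in> hom F2 SL2"
    using hom_compose[OF f(1) h(1)] by (simp add: comp_def)
  \<comment> \<open>A preimage of the class of \<open>ab\<close>, whose matrix \<open>AB\<close> has
    nonconstant trace.\<close>
  obtain w where w: "w \<in> carrier F2" "f w = K_CpCp p #>\<^bsub>F2\<^esub> (gen_a \<otimes>\<^bsub>F2\<^esub> gen_b)"
    using f(2) q.hom_closed[of "gen_a \<otimes>\<^bsub>F2\<^esub> gen_b"] by (metis F.m_closed free_gen_closed imageE)
  have "degree (mat2_trace (h (f w))) = 0"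
    by (rule trace_constant_of_relators[OF hf p(2) _ _ w(1)])
      (simp_all add: rel twist_power_relators)
  moreover have "h (f w) = A \<otimes>\<^bsub>SL2\<^esub> B"
    using h(2)[of "gen_a \<otimes>\<^bsub>F2\<^esub> gen_b"] by (simp add: w(2) SL2.free_lift_gen[OF g] g_def)
  ultimately show False using AB(5) by simp
qed

lemma no_automorphism_into_K_CpCp:
  assumes p: "Factorial_Ring.prime p" "odd p"
    and \<theta>: "\<theta> \<in> iso F2 F2" and sub: "\<theta> ` N_H p \<subseteq> K_CpCp p"
  shows False
proof (rule no_surjection_onto_CpCp[OF p])
  interpret q: group_hom F2 "CpCp p" "\<lambda>w. K_CpCp p #>\<^bsub>F2\<^esub> w" by (rule group_hom_CpCp)
  have \<theta>_hom: "\<theta> \<in> hom F2 F2" and surj: "\<theta> ` carrier F2 = carrier F2"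
    using \<theta> by (auto simp: iso_def bij_betw_def)
  show "(\<lambda>w. K_CpCp p #>\<^bsub>F2\<^esub> \<theta> w) \<in> hom F2 (CpCp p)"
    using hom_compose[OF \<theta>_hom q.homh] by (simp add: comp_def)
  have "(\<lambda>w. K_CpCp p #>\<^bsub>F2\<^esub> \<theta> w) ` carrier F2 = (\<lambda>w. K_CpCp p #>\<^bsub>F2\<^esub> w) ` \<theta> ` carrier F2"
    by (simp add: image_image)
  then show "(\<lambda>w. K_CpCp p #>\<^bsub>F2\<^esub> \<theta> w) ` carrier F2 = carrier (CpCp p)"
    by (simp add: surj CpCp_def carrier_FactGroup)
  show "K_CpCp p #>\<^bsub>F2\<^esub> \<theta> r = \<one>\<^bsub>CpCp p\<^esub>" if "r \<in> twist ` power_relators p" for r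
  proof -
    have "\<theta> r \<in> K_CpCp p"
      using that relators_in_N_G N_G_subset_N_H sub by blast
    moreover from this have "\<theta> r \<in> carrier F2"
      using subgroup.mem_carrier[OF normal_imp_subgroup[OF normal_K_CpCp]] by blast
    ultimately show ?thesis
      unfolding CpCp_def using F.coset_eq_one_iff[OF normal_K_CpCp] by blast
  qed
qed

lemma not_iso_H_grp_CpCp:
  assumes p: "Factorial_Ring.prime p" "odd p"
  shows "\<not> H_grp p \<cong> CpCp p"
proof
  assume "H_grp p \<cong> CpCp p"
  then obtain h where h: "h \<in> hom (H_grp p) (CpCp p)" "h ` carrier (H_grp p) = carrier (CpCp p)"
    by (auto simp: is_iso_def iso_def bij_betw_def)
  interpret G: group "G_grp p" by (rule group_G_grp)
  interpret q: group_hom F2 "G_grp p" "\<lambda>w. N_G p #>\<^bsub>F2\<^esub> w" by (rule group_hom_G_grp)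
  let ?R = "nilpotent_residual (G_grp p)"
  interpret r: group_hom "G_grp p" "H_grp p" "\<lambda>x. ?R #>\<^bsub>G_grp p\<^esub> x"
    unfolding H_grp_eq by (rule G.group_hom_Mod[OF G.normal_nilpotent_residual])
  interpret h: group_hom "H_grp p" "CpCp p" h
    using h(1) group_hom_CpCp[of p] by (simp add: group_hom_def group_hom_axioms_def r.H.is_group)
  have sg: "carrier (G_grp p) = (\<lambda>w. N_G p #>\<^bsub>F2\<^esub> w) ` carrier F2"
    by (simp add: G_grp_def carrier_FactGroup)
  have sh: "carrier (H_grp p) = (\<lambda>x. ?R #>\<^bsub>G_grp p\<^esub> x) ` carrier (G_grp p)"
    by (simp add: H_grp_eq carrier_FactGroup)
  show False
  proof (rule no_surjection_onto_CpCp[OF p])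
    show "(\<lambda>w. h (?R #>\<^bsub>G_grp p\<^esub> (N_G p #>\<^bsub>F2\<^esub> w))) \<in> hom F2 (CpCp p)"
      using group_hom_comp[OF group_hom_comp[OF q.group_hom_axioms r.group_hom_axioms] h.group_hom_axioms]
      by (rule group_hom.homh)
    show "(\<lambda>w. h (?R #>\<^bsub>G_grp p\<^esub> (N_G p #>\<^bsub>F2\<^esub> w))) ` carrier F2 = carrier (CpCp p)"
      unfolding h(2)[symmetric] sh sg by (simp add: image_image)
    show "h (?R #>\<^bsub>G_grp p\<^esub> (N_G p #>\<^bsub>F2\<^esub> s)) = \<one>\<^bsub>CpCp p\<^esub>" if "s \<in> twist ` power_relators p" for s
    proof -
      have s: "s \<in> N_G p" "s \<in> carrier F2"
        using subsetD[OF relators_in_N_G that] subsetD[OF twist_power_relators_closed that] .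
      then have "N_G p #>\<^bsub>F2\<^esub> s = \<one>\<^bsub>G_grp p\<^esub>"
        unfolding G_grp_def using F.coset_eq_one_iff[OF normal_N_G s(2)] by blast
      then show ?thesis by simp
    qed
  qed
qed

text \<open>If some \<open>\<theta> w\<close> with \<open>w\<close> in \<open>N_H p\<close> lay
  outside \<open>K_CpCp p\<close>, a unitriangular group would detect it, contrary to the counting
  argument. So the reverse inclusion holds as well, which is impossible.\<close>

lemma not_type_I:
  assumes p: "Factorial_Ring.prime p" "odd p"
    and \<theta>: "\<theta> \<in> iso F2 F2" and sub: "K_CpCp p \<subseteq> \<theta> ` N_H p"
  shows False
proof (rule no_automorphism_into_K_CpCp[OF p \<theta>], rule image_subsetI, rule ccontr)
  fix w
  assume w: "w \<in> N_H p" and notin: "\<theta> w \<notin> K_CpCp p"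
  \<comment> \<open>The index \<open>Suc n\<close> is the one at which the lower central series of
    \<open>tri_group p n\<close> becomes trivial.\<close>
  have N_H: "u \<in> carrier F2 \<and> N_G p #>\<^bsub>F2\<^esub> u \<in> lower_central (F2 Mod N_G p) (Suc n)" if "u \<in> N_H p" for u n
    using that by (auto simp: N_H_eq nilpotent_residual_def G_grp_def)
  have \<theta>w: "\<theta> w \<in> carrier F2"
    using \<theta> N_H[OF w] by (auto simp: iso_def bij_betw_def)
  have "power_relators p = range (\<lambda>c. free_gen c [^]\<^bsub>F2\<^esub> p)"
    by (auto simp: power_relators_def UNIV_bool)
  then obtain g n where g: "range g \<subseteq> carrier (tri_group p n)"
    "\<And>c. g c [^]\<^bsub>tri_group p n\<^esub> p = \<one>\<^bsub>tri_group p n\<^esub>"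
    "free_lift (tri_group p n) g (\<theta> w) \<noteq> \<one>\<^bsub>tri_group p n\<^esub>"
    using cyclic_free_product_residually_tri[OF p(1) \<theta>w] notin[unfolded K_CpCp_eq] by metis
  interpret Q: group "tri_group p n" by (rule group_tri_group)
  interpret g: group_hom F2 "tri_group p n" "free_lift (tri_group p n) g"
    using Q.free_lift_hom[OF g(1)] by (simp add: group_hom_def group_hom_axioms_def group_free_group Q.is_group)
  have rel: "free_lift (tri_group p n) g s = \<one>\<^bsub>tri_group p n\<^esub>" if "s \<in> power_relators p" for s
    using that g(2) by (auto simp: power_relators_def g.hom_nat_pow Q.free_lift_gen[OF g(1)])
  have fin: "finite (carrier (tri_group p n))"
    using finite_tri_group prime_gt_0_nat[OF p(1)] by blast
  have "free_lift (tri_group p n) g (\<theta> w) = \<one>\<^bsub>tri_group p n\<^esub>"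
  proof (rule Q.finite_nilpotent_hom_kills_image[OF fin lower_central_tri_group ia_endo_twist
        power_relators_closed \<theta> _ g(1) rel])
    \<comment> \<open>The counting lemma refers only to level \<open>Suc n\<close>, where the kernel
      contains \<open>N_H p\<close>; the assumed inclusion therefore persists.\<close>
    have "N_H p \<subseteq> {w \<in> carrier F2. N_G p #>\<^bsub>F2\<^esub> w \<in> lower_central (F2 Mod N_G p) (Suc n)}"
      using N_H by blast
    then show "normal_closure F2 (power_relators p) \<subseteq> \<theta> ` {w \<in> carrier F2.
        normal_closure F2 (twist ` power_relators p) #>\<^bsub>F2\<^esub> w
        \<in> lower_central (F2 Mod normal_closure F2 (twist ` power_relators p)) (Suc n)}"
      using sub unfolding N_G_eq K_CpCp_eq by blast
    show "w \<in> carrier F2"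
      and "normal_closure F2 (twist ` power_relators p) #>\<^bsub>F2\<^esub> w
        \<in> lower_central (F2 Mod normal_closure F2 (twist ` power_relators p)) (Suc n)"
      using N_H[OF w, of n] unfolding N_G_eq by blast+
  qed
  with g(3) show False ..
qed

lemma lower_central_quotients_H_grp:
  assumes "1 \<le> i"
  shows "H_grp p Mod lower_central (H_grp p) i \<cong> CpCp p Mod lower_central (CpCp p) i"
proof -
  have "H_grp p Mod lower_central (H_grp p) i \<cong> G_grp p Mod lower_central (G_grp p) i"
    unfolding H_grp_eq by (rule group.Mod_residual_Mod_lower_central[OF group_G_grp assms])
  also have "G_grp p Mod lower_central (G_grp p) i \<cong> CpCp p Mod lower_central (CpCp p) i"
    unfolding G_grp_def CpCp_def N_G_eq K_CpCp_eq
    by (rule Mod_normal_closure_ia_endo[OF ia_endo_twist power_relators_closed])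
  finally show ?thesis .
qed

theorem mainTheorem13:
  fixes p :: nat
  assumes "Factorial_Ring.prime p" and "odd p"
  shows "para (H_grp p) (CpCp p)
       \<and> type_III F2 (N_H p) (K_CpCp p)
       \<and> residually_nilpotent (H_grp p)
       \<and> (\<forall>i\<ge>1. (H_grp p Mod lower_central (H_grp p) i) \<cong> (CpCp p Mod lower_central (CpCp p) i))
       \<and> \<not> (H_grp p \<cong> CpCp p)"
proof -
  have "residually_nilpotent (H_grp p)"
    unfolding H_grp_eq by (rule group.residually_nilpotent_Mod_residual[OF group_G_grp])
  moreover have "type_III F2 (N_H p) (K_CpCp p)"
    using not_type_I[OF assms] no_automorphism_into_K_CpCp[OF assms]
    by (auto simp: type_III_def type_I_def type_II_def)
  ultimately show ?thesis
    using lower_central_quotients_H_grp not_iso_H_grp_CpCp[OF assms]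
    by (simp add: para_def weakly_para_def)
qed

end
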